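(* Let $\mathbb K$ (the kite) be the graph with vertex set $\{1,2,3,4,5\}$ and edge set $\{12,23,24,34,35,45\}$. The problem $\mathbb K$-Induced Minor is solvable in polynomial time.
   Context: All graphs are finite and simple. A graph $G$ contains $H$ as an induced minor if $H$ can be obtained from $G$ by vertex deletions and edge contractions. The problem $H$-Induced Minor takes a graph $G$ as input and asks whether $G$ contains $H$ as an induced minor. *)

theory Defs
  imports
    "Graph_Theory.Pair_Digraph"
    "Graph_Theory.Digraph_Isomorphism"
    "HOL-Computational_Algebra.Polynomial"
begin

section \<open>Induced minors\<close>

text \<open>
  A finite simple graph is a \<^const>\<open>pair_graph\<close>: finite, loopless and symmetric,
  an undirected edge being represented by its two opposite arcs.
\<close>

definition pair_del_vert :: "'a \<Rightarrow> 'a pair_pre_digraph \<Rightarrow> 'a pair_pre_digraph" where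
  "pair_del_vert v G =
     \<lparr>pverts = pverts G - {v}, parcs = {(x, y) \<in> parcs G. x \<noteq> v \<and> y \<noteq> v}\<rparr>"

lemma with_proj_pair_del_vert:
  "with_proj (pair_del_vert v G) = pre_digraph.del_vert (with_proj G) v"
  by (auto simp: pair_del_vert_def pre_digraph.del_vert_def with_proj_def)

text \<open>
  The vertex arising from the contracted edge is named \<open>u\<close>. Parallel arcs coincide
  automatically; the loops at \<open>u\<close> are removed.
\<close>

definition pair_contract :: "'a \<Rightarrow> 'a \<Rightarrow> 'a pair_pre_digraph \<Rightarrow> 'a pair_pre_digraph" where
  "pair_contract u v G =
     (let r = id(v := u) in
      \<lparr>pverts = r ` pverts G, parcs = map_prod r r ` parcs G - Id\<rparr>)"

inductive induced_minor_step :: "'a pair_pre_digraph \<Rightarrow> 'a pair_pre_digraph \<Rightarrow> bool" where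
  delete: "v \<in> pverts G \<Longrightarrow> induced_minor_step G (pair_del_vert v G)"
| contract: "(u, v) \<in> parcs G \<Longrightarrow> induced_minor_step G (pair_contract u v G)"

definition contains_induced_minor :: "'a pair_pre_digraph \<Rightarrow> 'b pair_pre_digraph \<Rightarrow> bool" where
  "contains_induced_minor G H \<longleftrightarrow>
     (\<exists>G'. induced_minor_step\<^sup>*\<^sup>* G G' \<and> digraph_iso (with_proj G') (with_proj H))"

lemma pair_graph_del_vert:
  assumes "pair_graph G"
  shows "pair_graph (pair_del_vert v G)"
proof -
  interpret pair_graph G by fact
  have "finite {(x, y) \<in> parcs G. x \<noteq> v \<and> y \<noteq> v}"
    by (rule finite_subset[OF _ pair_finite_arcs]) auto
  then show ?thesis
    using pair_finite_verts arc_fst_in_verts arc_snd_in_verts pair_no_loops arcs_symmetric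
    by unfold_locales (fastforce simp: pair_del_vert_def symmetric_def intro: symI)+
qed

lemma pair_graph_contract:
  assumes "pair_graph G"
  shows "pair_graph (pair_contract u v G)"
proof -
  interpret pair_graph G by fact
  define r where "r = id(v := u)"
  have G: "pair_contract u v G = \<lparr>pverts = r ` pverts G, parcs = map_prod r r ` parcs G - Id\<rparr>"
    unfolding pair_contract_def r_def Let_def by (rule refl)
  have "sym (map_prod r r ` parcs G - Id)"
    using arcs_symmetric by (fastforce intro!: symI)
  then show ?thesis
    unfolding G using pair_finite_verts pair_finite_arcs in_arcsD1 in_arcsD2
    by unfold_locales (auto simp: symmetric_def)
qed

lemma pair_graph_induced_minor_step:
  "induced_minor_step G G' \<Longrightarrow> pair_graph G \<Longrightarrow> pair_graph G'"
  by (induction rule: induced_minor_step.induct)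
     (auto intro: pair_graph_del_vert pair_graph_contract)

definition kite :: "nat pair_pre_digraph" where
  "kite =
     (let E = {(1, 2), (2, 3), (2, 4), (3, 4), (3, 5), (4, 5)} in
      \<lparr>pverts = {1, 2, 3, 4, 5}, parcs = E \<union> converse E\<rparr>)"

lemma pair_graph_kite: "pair_graph kite"
  by unfold_locales (auto simp: kite_def symmetric_def intro!: symI)


section \<open>Polynomial time\<close>

text \<open>
  The machine model is the random access machine of Cook and Reckhow in load/store form: a
  program accesses finitely many registers directly, and an unbounded memory indirectly through
  addresses held in registers. All cells hold natural numbers, and every instruction costs one
  unit. As addition is the only instruction producing larger numbers, the contents of all cells
  have O(t + log n) bits after t steps on an input of length n, so that unit cost, logarithmic
  cost and Turing machine time are polynomially related. (This would fail with
  multiplication as a unit-cost instruction.)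
\<close>

datatype ram_instr =
    RConst nat nat
  | RAdd nat nat nat
  | RSub nat nat nat
  | RLoad nat nat
  | RStore nat nat
  | RJump nat nat

record ram_config =
  pc :: nat
  reg :: "nat \<Rightarrow> nat"
  mem :: "nat \<Rightarrow> nat"

text \<open>\<open>RSub\<close> is truncated subtraction; \<open>RJump i l\<close> jumps if register \<open>i\<close> is positive.\<close>

fun ram_exec :: "ram_instr \<Rightarrow> ram_config \<Rightarrow> ram_config" where
  "ram_exec (RConst i c) s = s\<lparr>pc := pc s + 1, reg := (reg s)(i := c)\<rparr>"
| "ram_exec (RAdd i j k) s = s\<lparr>pc := pc s + 1, reg := (reg s)(i := reg s j + reg s k)\<rparr>"
| "ram_exec (RSub i j k) s = s\<lparr>pc := pc s + 1, reg := (reg s)(i := reg s j - reg s k)\<rparr>"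
| "ram_exec (RLoad i j) s = s\<lparr>pc := pc s + 1, reg := (reg s)(i := mem s (reg s j))\<rparr>"
| "ram_exec (RStore i j) s = s\<lparr>pc := pc s + 1, mem := (mem s)(reg s i := reg s j)\<rparr>"
| "ram_exec (RJump i l) s = s\<lparr>pc := (if reg s i > 0 then l else pc s + 1)\<rparr>"

type_synonym ram_program = "ram_instr list"

definition ram_halted :: "ram_program \<Rightarrow> ram_config \<Rightarrow> bool" where
  "ram_halted P s \<longleftrightarrow> pc s \<ge> length P"

definition ram_step :: "ram_program \<Rightarrow> ram_config \<Rightarrow> ram_config" where
  "ram_step P s = (if ram_halted P s then s else ram_exec (P ! pc s) s)"

text \<open>
  Initially the input bits are in memory cells \<open>0, \<dots>, length w - 1\<close> and the
  input length is in register \<open>0\<close>.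
\<close>

definition ram_init :: "bool list \<Rightarrow> ram_config" where
  "ram_init w =
     \<lparr>pc = 0,
      reg = (\<lambda>_. 0)(0 := length w),
      mem = (\<lambda>i. if i < length w then of_bool (w ! i) else 0)\<rparr>"

text \<open>
  A halted machine stays put, so \<open>(ram_step P ^^ t) (ram_init w)\<close> is a halting
  configuration iff \<open>P\<close> halts on \<open>w\<close> within \<open>t\<close> steps. The verdict is read off register \<open>0\<close>.
\<close>

definition ram_decides_within ::
    "ram_program \<Rightarrow> bool list set \<Rightarrow> (nat \<Rightarrow> nat) \<Rightarrow> bool" where
  "ram_decides_within P L T \<longleftrightarrow>
     (\<forall>w. let s = (ram_step P ^^ T (length w)) (ram_init w) in
        ram_halted P s \<and> reg s 0 = of_bool (w \<in> L))"

definition polytime_decidable :: "bool list set \<Rightarrow> bool" where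
  "polytime_decidable L \<longleftrightarrow> (\<exists>P (p :: nat poly). ram_decides_within P L (poly p))"


section \<open>The problem \<open>H\<close>-Induced Minor\<close>

text \<open>An input graph with vertex set \<open>{0..<n}\<close> is given by its adjacency matrix, row by row.\<close>

definition adjacency_word :: "nat \<Rightarrow> nat pair_pre_digraph \<Rightarrow> bool list" where
  "adjacency_word n G = concat (map (\<lambda>i. map (\<lambda>j. (i, j) \<in> parcs G) [0..<n]) [0..<n])"

definition induced_minor_problem :: "'a pair_pre_digraph \<Rightarrow> bool list set" where
  "induced_minor_problem H =
     {adjacency_word n G | n G.
        pair_graph G \<and> pverts G = {0..<n} \<and> contains_induced_minor G H}"

lemma length_adjacency_word: "length (adjacency_word n G) = n * n"
  by (simp add: adjacency_word_def length_concat comp_def sum_list_triv)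

lemma adjacency_word_inject:
  assumes "pair_graph G" "pverts G = {0..<n}" "pair_graph G'" "pverts G' = {0..<n'}"
    and eq: "adjacency_word n G = adjacency_word n' G'"
  shows "G = G'"
proof -
  interpret G: pair_graph G by fact
  interpret G': pair_graph G' by fact
  have n: "n' = n"
    using arg_cong[OF eq, of length] by (simp add: length_adjacency_word flip: power2_eq_square)
  have "map (\<lambda>i. map (\<lambda>j. (i, j) \<in> parcs G) [0..<n]) [0..<n]
      = map (\<lambda>i. map (\<lambda>j. (i, j) \<in> parcs G') [0..<n]) [0..<n]"
    using eq unfolding n adjacency_word_def
    by (rule concat_injective) (auto simp: set_zip)
  then have "(i, j) \<in> parcs G \<longleftrightarrow> (i, j) \<in> parcs G'" if "i < n" "j < n" for i j
    using that by (simp add: list_eq_iff_nth_eq)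
  moreover have "i < n \<and> j < n" if "(i, j) \<in> parcs G \<or> (i, j) \<in> parcs G'" for i j
    using that assms(2,4) n G.in_arcsD1 G.in_arcsD2 G'.in_arcsD1 G'.in_arcsD2 by fastforce
  ultimately have "parcs G = parcs G'"
    by auto
  then show ?thesis
    using assms(2,4) n by (simp add: pair_pre_digraph.equality)
qed

lemma adjacency_word_in_induced_minor_problem:
  assumes "pair_graph G" "pverts G = {0..<n}"
  shows "adjacency_word n G \<in> induced_minor_problem H \<longleftrightarrow> contains_induced_minor G H"
  using assms adjacency_word_inject unfolding induced_minor_problem_def by blast

end

theory Submission
  imports Defs
begin

text \<open>
  A graph contains the kite as an induced minor iff it has five disjoint connected bags with the
  adjacencies of the kite. The bag of the pendant vertex \<open>1\<close> and that of the vertex \<open>5\<close> can be taken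
  to be singletons \<open>{a}\<close> and \<open>{e}\<close>, and a smallest bag \<open>B\<close> of the vertex \<open>2\<close> has at most three
  vertices: each of its non-cut vertices is indispensable, and indispensable vertices can be handed to
  other bags. Once \<open>a\<close>, \<open>B\<close>, \<open>e\<close> are fixed, the two remaining bags are two disjoint adjacent
  connected subgraphs of \<open>G - N[a] - B - e\<close>, each meeting \<open>N(B)\<close> and \<open>N(e)\<close>. By Menger's theorem they
  exist iff some component is such that no single vertex of it separates \<open>N(B)\<close> from \<open>N(e)\<close>. So the
  problem is defined by a first-order formula with reachability atoms, and such formulas are evaluated
  in polynomial time by nested loops.
\<close>

section \<open>Structured programs for the random access machine\<close>

text \<open>The obstacle is that an induced minor also prescribes non-adjacencies: \<open>a\<close>
  must see neither \<open>C\<close> nor \<open>D\<close>, and \<open>e\<close> must not see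
  \<open>B\<close>. So a vertex of \<open>B\<close> may be handed to \<open>C\<close> or
  \<open>D\<close> only if it is not adjacent to \<open>a\<close>. This is the origin of the bound
  three: if \<open>B\<close> cannot be made smaller this way, two of its non-cut vertices
  \<open>x\<close>, \<open>y\<close> are both adjacent to \<open>a\<close>, one being the only
  contact of \<open>B\<close> with \<open>C\<close>, the other the only contact with
  \<open>D\<close>; if \<open>B\<close> is large, \<open>{x, a, y}\<close> can replace it, with
  another vertex of \<open>B\<close> as the new pendant. No adjacency is forbidden between
  \<open>C\<close> or \<open>D\<close> and \<open>B\<close> or \<open>e\<close>. Hence, once
  \<open>a\<close>, \<open>B\<close>, \<open>e\<close> are fixed, all prohibitions for
  \<open>C\<close> and \<open>D\<close> are absorbed by deleting \<open>N[a]\<close>, and a pure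
  linkage problem remains. The contact between \<open>C\<close> and \<open>D\<close> comes for free:
  inside a component one of them can grow until it meets the other. On the machine, every variable
  ranges over the numbers up to the input length, and reachability atoms are never nested, so that
  one scratch area in memory serves all searches.\<close>

datatype cmd = Ins ram_instr | Seq cmd cmd (infixr ";;" 60) | IfZ nat cmd | For nat cmd

fun csize :: "cmd \<Rightarrow> nat" where
  "csize (Ins i) = 1"
| "csize (c ;; d) = csize c + csize d"
| "csize (IfZ i c) = csize c + 1"
| "csize (For i c) = csize c + 4"

text \<open>
  The loop runs its counter \<open>i\<close> through all values below the contents of register \<open>1\<close>, which must be
  positive as the test comes last. Register \<open>2\<close> must hold \<open>1\<close>; register \<open>4\<close> is scratch.
\<close>

fun compile :: "nat \<Rightarrow> cmd \<Rightarrow> ram_program" where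
  "compile b (Ins i) = [i]"
| "compile b (c ;; d) = compile b c @ compile (b + csize c) d"
| "compile b (IfZ i c) = RJump i (b + 1 + csize c) # compile (b + 1) c"
| "compile b (For i c) = RConst i 0 # compile (b + 1) c @ [RAdd i i 2, RSub 4 1 i, RJump 4 (b + 1)]"

lemma length_compile [simp]: "length (compile b c) = csize c"
  by (induction c arbitrary: b) auto

text \<open>A relocatable total-correctness triple: the code may sit anywhere in a program, its
  jumps being compiled for the address where it starts, and within \<open>T\<close> steps control
  arrives just behind it. Assertions see registers and memory but not the program counter.\<close>

definition triple :: "nat \<Rightarrow> ((nat \<Rightarrow> nat) \<Rightarrow> (nat \<Rightarrow> nat) \<Rightarrow> bool) \<Rightarrow> cmd \<Rightarrow>
    ((nat \<Rightarrow> nat) \<Rightarrow> (nat \<Rightarrow> nat) \<Rightarrow> bool) \<Rightarrow> bool" where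
  "triple T Pre c Post \<longleftrightarrow> (\<forall>P xs ys s. P = xs @ compile (length xs) c @ ys \<longrightarrow> pc s = length xs \<longrightarrow>
     Pre (reg s) (mem s) \<longrightarrow> (\<exists>t\<le>T. \<exists>s'. (ram_step P ^^ t) s = s' \<and>
       pc s' = length xs + csize c \<and> Post (reg s') (mem s')))"

lemma tripleI:
  assumes "\<And>P xs ys s. P = xs @ compile (length xs) c @ ys \<Longrightarrow> pc s = length xs \<Longrightarrow>
     Pre (reg s) (mem s) \<Longrightarrow> \<exists>t\<le>T. \<exists>s'. (ram_step P ^^ t) s = s' \<and>
       pc s' = length xs + csize c \<and> Post (reg s') (mem s')"
  shows "triple T Pre c Post"
  using assms unfolding triple_def by blast

lemma tripleE:
  assumes "triple T Pre c Post" "P = xs @ compile (length xs) c @ ys" "pc s = length xs"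
     "Pre (reg s) (mem s)"
  obtains t s' where "t \<le> T" "(ram_step P ^^ t) s = s'"
       "pc s' = length xs + csize c" "Post (reg s') (mem s')"
  using assms unfolding triple_def by blast

lemma ram_step_nth:
  assumes "P = xs @ i # ys" "pc s = length xs"
  shows "ram_step P s = ram_exec i s"
  using assms by (simp add: ram_step_def ram_halted_def)

lemma funpow_trans: "(f ^^ t) s = s' \<Longrightarrow> (f ^^ u) s' = s'' \<Longrightarrow> (f ^^ (t + u)) s = s''"
  by (subst add.commute) (simp add: funpow_add)

lemma triple_conseq:
  assumes "triple T Pre c Post" "\<And>r m. Pre' r m \<Longrightarrow> Pre r m" "\<And>r m. Post r m \<Longrightarrow> Post' r m" "T \<le> T'"
  shows "triple T' Pre' c Post'"
proof (rule tripleI)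
  fix P xs ys and s :: ram_config
  assume A: "P = xs @ compile (length xs) c @ ys" "pc s = length xs" "Pre' (reg s) (mem s)"
  obtain t s' where "t \<le> T" "(ram_step P ^^ t) s = s'"
       "pc s' = length xs + csize c" "Post (reg s') (mem s')"
    using tripleE[OF assms(1) A(1,2) assms(2)[OF A(3)]] .
  then show "\<exists>t\<le>T'. \<exists>s'. (ram_step P ^^ t) s = s' \<and> pc s' = length xs + csize c \<and> Post' (reg s') (mem s')"
    using assms(3,4) le_trans by blast
qed

lemma triple_seq:
  assumes "triple T Pre c Q" "triple U Q d Post"
  shows "triple (T + U) Pre (c ;; d) Post"
proof (rule tripleI)
  fix P xs ys and s :: ram_config
  assume A: "P = xs @ compile (length xs) (c ;; d) @ ys" "pc s = length xs" "Pre (reg s) (mem s)"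
  have P1: "P = xs @ compile (length xs) c @ (compile (length xs + csize c) d @ ys)"
    using A(1) by simp
  obtain t s' where 1: "t \<le> T" "(ram_step P ^^ t) s = s'"
       "pc s' = length xs + csize c" "Q (reg s') (mem s')"
    using tripleE[OF assms(1) P1 A(2,3)] .
  have P2: "P = (xs @ compile (length xs) c) @ compile (length (xs @ compile (length xs) c)) d @ ys"
    using A(1) by simp
  obtain u s'' where 2: "u \<le> U" "(ram_step P ^^ u) s' = s''"
       "pc s'' = length (xs @ compile (length xs) c) + csize d" "Post (reg s'') (mem s'')"
    using tripleE[OF assms(2) P2 _ 1(4)] 1(3) by auto
  have "t + u \<le> T + U" "(ram_step P ^^ (t + u)) s = s''"
    using 1 2 by (auto intro: funpow_trans)
  with 2 show "\<exists>t\<le>T + U. \<exists>s'. (ram_step P ^^ t) s = s' \<and>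
       pc s' = length xs + csize (c ;; d) \<and> Post (reg s') (mem s')"
    by (intro exI[of _ "t + u"] conjI exI[of _ s'']) auto
qed

lemma triple_ins:
  assumes "\<And>i l. instr \<noteq> RJump i l"
    and "\<And>r m p. Pre r m \<Longrightarrow> Post (reg (ram_exec instr \<lparr>pc = p, reg = r, mem = m\<rparr>))
          (mem (ram_exec instr \<lparr>pc = p, reg = r, mem = m\<rparr>))"
  shows "triple 1 Pre (Ins instr) Post"
proof (rule tripleI)
  fix P xs ys and s :: ram_config
  assume A: "P = xs @ compile (length xs) (Ins instr) @ ys" "pc s = length xs" "Pre (reg s) (mem s)"
  have "ram_step P s = ram_exec instr s"
    using A by (intro ram_step_nth[of _ xs _ ys]) auto
  moreover have "pc (ram_exec instr s) = length xs + 1"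
    using assms(1) A(2) by (cases instr) auto
  moreover have "Post (reg (ram_exec instr s)) (mem (ram_exec instr s))"
    using assms(2)[OF A(3), of "pc s"] by (cases s) simp
  ultimately show "\<exists>t\<le>1. \<exists>s'. (ram_step P ^^ t) s = s' \<and>
       pc s' = length xs + csize (Ins instr) \<and> Post (reg s') (mem s')"
    by (intro exI[of _ 1]) auto
qed

lemma triple_ifz:
  assumes "triple T (\<lambda>r m. Pre r m \<and> r i = 0) c Post" "\<And>r m. Pre r m \<Longrightarrow> r i > 0 \<Longrightarrow> Post r m"
  shows "triple (T + 1) Pre (IfZ i c) Post"
proof (rule tripleI)
  fix P xs ys and s :: ram_config
  assume A: "P = xs @ compile (length xs) (IfZ i c) @ ys" "pc s = length xs" "Pre (reg s) (mem s)"
  let ?l = "length xs + 1 + csize c"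
  have S: "ram_step P s = s\<lparr>pc := (if reg s i > 0 then ?l else pc s + 1)\<rparr>"
    by (subst ram_step_nth[of P xs "RJump i ?l" "compile (length xs + 1) c @ ys"]) (use A in auto)
  show "\<exists>t\<le>T + 1. \<exists>s'. (ram_step P ^^ t) s = s' \<and>
       pc s' = length xs + csize (IfZ i c) \<and> Post (reg s') (mem s')"
  proof (cases "reg s i > 0")
    case True
    then show ?thesis using S A assms(2) by (intro exI[of _ 1]) auto
  next
    case False
    have P1: "P = (xs @ [RJump i ?l]) @ compile (length (xs @ [RJump i ?l])) c @ ys"
      using A(1) by simp
    obtain u s'' where 2: "u \<le> T" "(ram_step P ^^ u) (ram_step P s) = s''"
       "pc s'' = length (xs @ [RJump i ?l]) + csize c" "Post (reg s'') (mem s'')"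
      using tripleE[OF assms(1) P1, of "ram_step P s"] A S False by auto
    then show ?thesis
      by (intro exI[of _ "Suc u"]) (auto simp: funpow_Suc_right simp del: funpow.simps)
  qed
qed

text \<open>The loop tail overwrites the counter \<open>i\<close> and the scratch register 4, so the
  body has to establish the next invariant for the state after these two updates, whatever ends up
  in register 4. The cost is one step of initialisation and three steps of tail per
  iteration.\<close>

lemma triple_for:
  assumes body: "\<And>k. k < M \<Longrightarrow> triple T (\<lambda>r m. I k r m \<and> r i = k) c
      (\<lambda>r m. r i = k \<and> r 1 = M \<and> r 2 = 1 \<and> (\<forall>t. I (Suc k) (r(i := Suc k, 4 := t)) m))"
    and M: "M > 0" and i: "i \<noteq> 1" "i \<noteq> 2" "i \<noteq> 4"
  shows "triple (M * (T + 3) + 1) (\<lambda>r m. I 0 (r(i := 0)) m) (For i c) (I M)"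
proof (rule tripleI)
  fix P xs ys and s :: ram_config
  assume A: "P = xs @ compile (length xs) (For i c) @ ys" "pc s = length xs" "I 0 ((reg s)(i := 0)) (mem s)"
  let ?n = "length xs + 1"
  let ?xs1 = "xs @ [RConst i 0]"
  let ?xs2 = "?xs1 @ compile ?n c"
  let ?e = "[RAdd i i 2, RSub 4 1 i, RJump 4 ?n]"
  have P1: "P = ?xs1 @ compile (length ?xs1) c @ (?e @ ys)" using A(1) by simp
  have iter: "\<exists>u\<le>T + 3. \<exists>s'. (ram_step P ^^ u) s = s' \<and> pc s' = (if Suc k < M then ?n else ?n + csize c + 3)
        \<and> I (Suc k) (reg s') (mem s') \<and> reg s' i = Suc k"
    if k: "k < M" and s: "pc s = ?n" "I k (reg s) (mem s)" "reg s i = k" for k and s :: ram_config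
  proof -
    obtain u s1 where 1: "u \<le> T" "(ram_step P ^^ u) s = s1"
       "pc s1 = length ?xs1 + csize c"
       "reg s1 i = k" "reg s1 1 = M" "reg s1 2 = 1"
       "\<And>t. I (Suc k) ((reg s1)(i := Suc k, 4 := t)) (mem s1)"
      by (rule tripleE[OF body[OF k] P1, of s]) (use s in auto)
    define s2 where "s2 = s1\<lparr>pc := ?n + csize c + 1, reg := (reg s1)(i := Suc k)\<rparr>"
    have s2: "ram_step P s1 = s2"
      by (subst ram_step_nth[of P ?xs2 "RAdd i i 2" "tl ?e @ ys"]) (use A(1) 1 i in \<open>auto simp: s2_def\<close>)
    define s3 where "s3 = s2\<lparr>pc := ?n + csize c + 2, reg := (reg s2)(4 := M - Suc k)\<rparr>"
    have s3: "ram_step P s2 = s3"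
      by (subst ram_step_nth[of P "?xs2 @ [RAdd i i 2]" "RSub 4 1 i" "tl (tl ?e) @ ys"])
         (use A(1) 1 i in \<open>auto simp: s2_def s3_def\<close>)
    have s4: "ram_step P s3 = s3\<lparr>pc := (if Suc k < M then ?n else ?n + csize c + 3)\<rparr>"
      by (subst ram_step_nth[of P "?xs2 @ [RAdd i i 2, RSub 4 1 i]" "RJump 4 ?n" "ys"])
         (use A(1) 1 i in \<open>auto simp: s3_def\<close>)
    have "(ram_step P ^^ (Suc (Suc (Suc u)))) s = s3\<lparr>pc := (if Suc k < M then ?n else ?n + csize c + 3)\<rparr>"
      using 1(2) s2 s3 s4 by simp
    then show ?thesis
      by (intro exI[of _ "Suc (Suc (Suc u))"] conjI exI, use 1 i in \<open>auto simp: s3_def s2_def\<close>)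
  qed
  \<comment> \<open>Induction on the number \<open>j\<close> of remaining iterations;
    \<open>j = 0\<close> is excluded because the test comes after the body.\<close>
  have loop: "\<exists>u\<le>j * (T + 3). \<exists>s'. (ram_step P ^^ u) s = s' \<and> pc s' = ?n + csize c + 3 \<and> I M (reg s') (mem s')"
    if "k + j = M" "j > 0" "pc s = ?n" "I k (reg s) (mem s)" "reg s i = k" for j k and s :: ram_config
    using that
  proof (induction j arbitrary: k s)
    case (Suc j)
    obtain u s' where u: "u \<le> T + 3" "(ram_step P ^^ u) s = s'" "pc s' = (if Suc k < M then ?n else ?n + csize c + 3)"
        "I (Suc k) (reg s') (mem s')" "reg s' i = Suc k"
      using iter[of k s] Suc.prems by auto
    show ?case
    proof (cases "j = 0")
      case True
      with u Suc.prems show ?thesis by (intro exI[of _ u]) auto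
    next
      case False
      then obtain v s'' where v: "v \<le> j * (T + 3)" "(ram_step P ^^ v) s' = s''" "pc s'' = ?n + csize c + 3"
        "I M (reg s'') (mem s'')"
        using Suc.IH[of "Suc k" s'] u Suc.prems by auto
      then show ?thesis using u
        by (intro exI[of _ "u + v"] conjI exI[of _ s'']) (auto intro: funpow_trans)
    qed
  qed simp
  define s1 where "s1 = s\<lparr>pc := ?n, reg := (reg s)(i := 0)\<rparr>"
  have s1: "ram_step P s = s1"
    by (subst ram_step_nth[of P xs "RConst i 0" "compile ?n c @ ?e @ ys"]) (use A in \<open>auto simp: s1_def\<close>)
  obtain u s' where u: "u \<le> M * (T + 3)" "(ram_step P ^^ u) s1 = s'" "pc s' = ?n + csize c + 3" "I M (reg s') (mem s')"
    using loop[of 0 M s1] M A by (auto simp: s1_def)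
  show "\<exists>t\<le>M * (T + 3) + 1. \<exists>s'. (ram_step P ^^ t) s = s' \<and>
       pc s' = length xs + csize (For i c) \<and> I M (reg s') (mem s')"
    using u s1 by (intro exI[of _ "Suc u"]) (auto simp: funpow_Suc_right simp del: funpow.simps)
qed

section \<open>Formulas decidable in polynomial time\<close>

text \<open>Straight-line code is executed symbolically by \<open>fold effect\<close>. Registers and
  memory after an instruction do not depend on the program counter, which is therefore fixed to
  0.\<close>

definition effect :: "ram_instr \<Rightarrow> (nat \<Rightarrow> nat) \<times> (nat \<Rightarrow> nat) \<Rightarrow> (nat \<Rightarrow> nat) \<times> (nat \<Rightarrow> nat)" where
  "effect i = (\<lambda>(r, m). let s = ram_exec i \<lparr>pc = 0, reg = r, mem = m\<rparr> in (reg s, mem s))"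

fun block :: "ram_instr list \<Rightarrow> cmd" where
  "block [] = Ins (RAdd 5 5 5)"
| "block [i] = Ins i"
| "block (i # j # is) = Ins i ;; block (j # is)"

lemma triple_vacuous: "(\<And>r m. \<not> Pre r m) \<Longrightarrow> triple T Pre c Post"
  by (simp add: triple_def)

fun is_jump :: "ram_instr \<Rightarrow> bool" where
  "is_jump (RJump i l) = True"
| "is_jump _ = False"

lemma triple_effect:
  assumes "\<not> is_jump i"
  shows "triple 1 (\<lambda>r m. case_prod Post (effect i (r, m))) (Ins i) Post"
  by (rule triple_ins) (use assms in \<open>cases i; auto simp: effect_def Let_def\<close>)+

lemma triple_block:
  assumes "is \<noteq> []" "list_all (\<lambda>i. \<not> is_jump i) is"
    and "\<And>r m. Pre r m \<Longrightarrow> case_prod Post (fold effect is (r, m))"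
  shows "triple (length is) Pre (block is) Post"
  using assms
proof (induction "is" arbitrary: Pre rule: block.induct)
  case (2 i)
  show ?case
    unfolding block.simps
    by (rule triple_conseq[OF triple_effect[of i Post]]) (use 2 in auto)
next
  case (3 i j "is")
  let ?Q = "\<lambda>r m. case_prod Post (fold effect (j # is) (r, m))"
  have "triple (length (j # is)) ?Q (block (j # is)) Post"
    by (rule 3(1)) (use 3 in auto)
  from triple_seq[OF triple_effect[of i ?Q] this] 3
  have "triple (1 + length (j # is)) (\<lambda>r m. case_prod ?Q (effect i (r, m))) (block (i # j # is)) Post"
    by simp
  then show ?case
    by (rule triple_conseq) (use 3 in \<open>auto simp: split_beta\<close>)
qed auto

text \<open>
  Variable \<open>v\<close> of a formula is kept in register \<open>10 + v\<close>; registers \<open>3, \<dots>, 9\<close> are scratch, and \<open>3\<close>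
  receives truth values. The memory behind the input is used for graph search, so code that runs inside
  a search must leave it alone: this is what \<open>pres\<close> demands.
\<close>

definition ok :: "bool \<Rightarrow> (nat \<Rightarrow> nat) \<Rightarrow> bool list \<Rightarrow> nat \<Rightarrow> (nat \<Rightarrow> nat) \<Rightarrow> (nat \<Rightarrow> nat) \<Rightarrow> (nat \<Rightarrow> nat) \<Rightarrow> bool" where
  "ok pres m0 w d e r m \<longleftrightarrow> r 0 = length w \<and> r 1 = Suc (length w) \<and> r 2 = 1 \<and>
     (\<forall>i<length w. m i = of_bool (w ! i)) \<and> (pres \<longrightarrow> m = m0) \<and> (\<forall>v<d. r (10 + v) = e v)"

lemma ok_upd [simp]:
  assumes "3 \<le> i \<and> i < 10 \<or> 10 + d \<le> i"
  shows "ok pres m0 w d e (r(i := x)) m \<longleftrightarrow> ok pres m0 w d e r m"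
  using assms unfolding ok_def by auto

lemma ok_Suc: "ok pres m0 w (Suc d) e r m \<longleftrightarrow> ok pres m0 w d e r m \<and> r (10 + d) = e d"
  unfolding ok_def by (auto simp: less_Suc_eq)

lemma ok_env_upd [simp]: "d \<le> v \<Longrightarrow> ok pres m0 w d (e(v := k)) r m \<longleftrightarrow> ok pres m0 w d e r m"
  unfolding ok_def by auto

lemma okD: "ok pres m0 w d e r m \<Longrightarrow> r 0 = length w \<and> r 1 = Suc (length w) \<and> r (Suc 0) = Suc (length w) \<and> r 2 = 1"
  unfolding ok_def by auto

text \<open>One program and one polynomial serve all inputs and all values of the \<open>d\<close>
  variables in scope. These values are bounded by the input length, so a quantifier becomes a loop
  with linearly many iterations. As \<open>m0\<close> is arbitrary, the case
  \<open>pres = True\<close> says that the memory is left unchanged.\<close>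

definition dec :: "bool \<Rightarrow> nat \<Rightarrow> (bool list \<Rightarrow> (nat \<Rightarrow> nat) \<Rightarrow> bool) \<Rightarrow> bool" where
  "dec pres d P \<longleftrightarrow> (\<exists>c (p :: nat poly). \<forall>w e m0. (\<forall>v<d. e v \<le> length w) \<longrightarrow>
     triple (poly p (length w)) (ok pres m0 w d e) c
       (\<lambda>r m. ok pres m0 w d e r m \<and> r 3 = of_bool (P w e)))"

lemma decI:
  assumes "\<And>w e m0. \<forall>v<d. e v \<le> length w \<Longrightarrow>
     triple (poly p (length w)) (ok pres m0 w d e) c
       (\<lambda>r m. ok pres m0 w d e r m \<and> r 3 = of_bool (P w e))"
  shows "dec pres d P"
  unfolding dec_def by (rule exI[of _ c], rule exI[of _ p]) (use assms in blast)

lemma decE: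
  assumes "dec pres d P"
  obtains p :: "nat poly" and c where
    "\<And>w e m0. \<forall>v<d. e v \<le> length w \<Longrightarrow>
     triple (poly p (length w)) (ok pres m0 w d e) c
       (\<lambda>r m. ok pres m0 w d e r m \<and> r 3 = of_bool (P w e))"
proof -
  obtain c and p :: "nat poly" where "\<forall>w e m0. (\<forall>v<d. e v \<le> length w) \<longrightarrow>
     triple (poly p (length w)) (ok pres m0 w d e) c
       (\<lambda>r m. ok pres m0 w d e r m \<and> r 3 = of_bool (P w e))"
    using assms unfolding dec_def by (elim exE)
  then show ?thesis by (intro that[of p c]) blast
qed

section \<open>Closure under connectives and bounded quantifiers\<close>

lemma dec_not:
  assumes "dec pres d P"
  shows "dec pres d (\<lambda>w e. \<not> P w e)"
proof -
  obtain p c where c: "\<And>w e m0. \<forall>v<d. e v \<le> length w \<Longrightarrow>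
     triple (poly p (length w)) (ok pres m0 w d e) c
       (\<lambda>r m. ok pres m0 w d e r m \<and> r 3 = of_bool (P w e))"
    by (rule decE[OF assms]) blast
  show ?thesis
  proof (rule decI)
    fix w :: "bool list" and m0 and e :: "nat \<Rightarrow> nat" assume e: "\<forall>v<d. e v \<le> length w"
    have "triple (poly p (length w) + length [RSub 3 2 3]) (ok pres m0 w d e) (c ;; block [RSub 3 2 3])
       (\<lambda>r m. ok pres m0 w d e r m \<and> r 3 = of_bool (\<not> P w e))"
      by (rule triple_seq, rule c[OF e], rule triple_block) (auto simp: effect_def ok_def)
    then show "triple (poly (p + 1) (length w)) (ok pres m0 w d e) (c ;; block [RSub 3 2 3])
       (\<lambda>r m. ok pres m0 w d e r m \<and> r 3 = of_bool (\<not> P w e))"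
      by simp
  qed
qed

lemma dec_or:
  assumes "dec pres d P" "dec pres d Q"
  shows "dec pres d (\<lambda>w e. P w e \<or> Q w e)"
proof -
  obtain p c where c: "\<And>w e m0. \<forall>v<d. e v \<le> length w \<Longrightarrow>
     triple (poly p (length w)) (ok pres m0 w d e) c
       (\<lambda>r m. ok pres m0 w d e r m \<and> r 3 = of_bool (P w e))"
    by (rule decE[OF assms(1)]) blast
  obtain p' c' where c': "\<And>w e m0. \<forall>v<d. e v \<le> length w \<Longrightarrow>
     triple (poly p' (length w)) (ok pres m0 w d e) c'
       (\<lambda>r m. ok pres m0 w d e r m \<and> r 3 = of_bool (Q w e))"
    by (rule decE[OF assms(2)]) blast
  show ?thesis
  proof (rule decI)
    fix w :: "bool list" and m0 and e :: "nat \<Rightarrow> nat" assume e: "\<forall>v<d. e v \<le> length w"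
    \<comment> \<open>The second formula is evaluated only if the first is false; if it is true,
      this precondition is contradictory and register 3 already holds the answer.\<close>
    have 1: "triple (poly p' (length w)) (\<lambda>r m. (ok pres m0 w d e r m \<and> r 3 = of_bool (P w e)) \<and> r 3 = 0) c'
       (\<lambda>r m. ok pres m0 w d e r m \<and> r 3 = of_bool (P w e \<or> Q w e))"
    proof (cases "P w e")
      case True
      then show ?thesis by (intro triple_vacuous) auto
    next
      case False
      show ?thesis
        by (rule triple_conseq[OF c'[OF e]]) (use False in auto)
    qed
    have "triple (poly p (length w) + (poly p' (length w) + 1)) (ok pres m0 w d e) (c ;; IfZ 3 c')
       (\<lambda>r m. ok pres m0 w d e r m \<and> r 3 = of_bool (P w e \<or> Q w e))"
      by (rule triple_seq[OF c[OF e]], rule triple_ifz[OF 1]) auto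
    then show "triple (poly (p + (p' + 1)) (length w)) (ok pres m0 w d e) (c ;; IfZ 3 c')
       (\<lambda>r m. ok pres m0 w d e r m \<and> r 3 = of_bool (P w e \<or> Q w e))"
      by simp
  qed
qed

lemma dec_and:
  assumes "dec pres d P" "dec pres d Q"
  shows "dec pres d (\<lambda>w e. P w e \<and> Q w e)"
  using dec_not[OF dec_or[OF dec_not[OF assms(1)] dec_not[OF assms(2)]]] by simp

lemma dec_imp:
  assumes "dec pres d P" "dec pres d Q"
  shows "dec pres d (\<lambda>w e. P w e \<longrightarrow> Q w e)"
  using dec_or[OF dec_not[OF assms(1)] assms(2)] by (simp only: imp_conv_disj)

lemma dec_iff:
  assumes "dec pres d P" "dec pres d Q"
  shows "dec pres d (\<lambda>w e. P w e \<longleftrightarrow> Q w e)"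
  using dec_and[OF dec_imp[OF assms] dec_imp[OF assms(2,1)]] by (simp only: iff_conv_conj_imp)

text \<open>The bound variable gets the next index \<open>d\<close>, so its register can be the loop
  counter; once a witness is found, register 3 is positive and the later iterations skip the body.
  The second assumption says that \<open>P\<close> sees this variable only through its last
  argument.\<close>

lemma dec_ex:
  assumes "dec pres (Suc d) (\<lambda>w e. P w e (e d))"
    and "\<And>w e k j. P w (e(d := j)) k = P w e k"
  shows "dec pres d (\<lambda>w e. \<exists>k\<le>length w. P w e k)"
proof -
  obtain p c where c: "\<And>w e m0. \<forall>v<Suc d. e v \<le> length w \<Longrightarrow>
     triple (poly p (length w)) (ok pres m0 w (Suc d) e) c
       (\<lambda>r m. ok pres m0 w (Suc d) e r m \<and> r 3 = of_bool (P w e (e d)))"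
    by (rule decE[OF assms(1)]) blast
  let ?c = "block [RConst 3 0] ;; For (10 + d) (IfZ 3 c)"
  show ?thesis
  proof (rule decI)
    fix w :: "bool list" and m0 and e :: "nat \<Rightarrow> nat" assume e: "\<forall>v<d. e v \<le> length w"
    define I where "I k = (\<lambda>r m. ok pres m0 w d e r m \<and> r 3 = of_bool (\<exists>j<k. P w e j))" for k
    have 1: "triple (poly p (length w) + 1) (\<lambda>r m. I k r m \<and> r (10 + d) = k) (IfZ 3 c)
      (\<lambda>r m. r (10 + d) = k \<and> r 1 = Suc (length w) \<and> r 2 = 1 \<and> (\<forall>t. I (Suc k) (r(10 + d := Suc k, 4 := t)) m))"
      if k: "k < Suc (length w)" for k
    proof (rule triple_ifz)
      show "triple (poly p (length w)) (\<lambda>r m. (I k r m \<and> r (10 + d) = k) \<and> r 3 = 0) c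
        (\<lambda>r m. r (10 + d) = k \<and> r 1 = Suc (length w) \<and> r 2 = 1 \<and> (\<forall>t. I (Suc k) (r(10 + d := Suc k, 4 := t)) m))"
      proof (cases "\<exists>j<k. P w e j")
        case True
        then show ?thesis by (intro triple_vacuous) (auto simp: I_def)
      next
        case False
        then have ex: "(\<exists>j<Suc k. P w e j) \<longleftrightarrow> P w e k"
          using less_Suc_eq by blast
        have ek: "\<forall>v<Suc d. (e(d := k)) v \<le> length w"
          using e k by (auto simp: less_Suc_eq)
        show ?thesis
          by (rule triple_conseq[OF c[of "e(d := k)" w m0, OF ek]])
            (simp_all add: I_def assms(2) ok_Suc ex, simp add: ok_def)
      qed
      show "r (10 + d) = k \<and> r 1 = Suc (length w) \<and> r 2 = 1 \<and> (\<forall>t. I (Suc k) (r(10 + d := Suc k, 4 := t)) m)"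
        if "I k r m \<and> r (10 + d) = k" "r 3 > 0" for r m
      proof -
        have "\<exists>j<k. P w e j" using that by (auto simp: I_def split: if_splits)
        then have "\<exists>j<Suc k. P w e j" using less_SucI by blast
        then show ?thesis using that okD(1)[of pres m0 w d e r m] by (simp add: I_def)
      qed
    qed
    have "triple (length [RConst 3 0] + (Suc (length w) * ((poly p (length w) + 1) + 3) + 1)) (ok pres m0 w d e) ?c (I (Suc (length w)))"
      by (rule triple_seq[OF triple_block triple_for[OF 1]]) (auto simp: effect_def I_def)
    then show "triple (poly (1 + ([:1, 1:] * (p + 1 + 3) + 1)) (length w)) (ok pres m0 w d e) ?c
       (\<lambda>r m. ok pres m0 w d e r m \<and> r 3 = of_bool (\<exists>k\<le>length w. P w e k))"
      by (simp add: I_def less_Suc_eq_le)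
  qed
qed

lemma dec_all:
  assumes "dec pres (Suc d) (\<lambda>w e. P w e (e d))"
    and "\<And>w e k j. P w (e(d := j)) k = P w e k"
  shows "dec pres d (\<lambda>w e. \<forall>k\<le>length w. P w e k)"
proof -
  have "dec pres d (\<lambda>w e. \<not> (\<exists>k\<le>length w. \<not> P w e k))"
    by (rule dec_not, rule dec_ex[where P = "\<lambda>w e k. \<not> P w e k"], rule dec_not, rule assms(1)) (simp add: assms(2))
  then show ?thesis by simp
qed

section \<open>Arithmetic atoms and input bits\<close>

lemma dec_less:
  assumes "x < d" "y < d"
  shows "dec pres d (\<lambda>w e. e x < e y)"
proof (rule decI)
  fix w :: "bool list" and m0 and e :: "nat \<Rightarrow> nat"
  \<comment> \<open>Truncated subtraction from 1, done twice, turns any positive difference into 1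
    and keeps 0.\<close>
  let ?is = "[RSub 5 (10 + y) (10 + x), RSub 6 2 5, RSub 3 2 6]"
  have "triple (length ?is) (ok pres m0 w d e) (block ?is) (\<lambda>r m. ok pres m0 w d e r m \<and> r 3 = of_bool (e x < e y))"
    by (rule triple_block) (use assms in \<open>auto simp: effect_def ok_def\<close>)
  then show "triple (poly 3 (length w)) (ok pres m0 w d e) (block ?is) (\<lambda>r m. ok pres m0 w d e r m \<and> r 3 = of_bool (e x < e y))"
    by (rule triple_conseq) simp_all
qed

lemma dec_eq:
  assumes "x < d" "y < d"
  shows "dec pres d (\<lambda>w e. e x = e y)"
proof -
  have "dec pres d (\<lambda>w e. \<not> (e x < e y) \<and> \<not> (e y < e x))"
    by (intro dec_and dec_not dec_less assms)
  moreover have "(\<not> a < b \<and> \<not> b < a) \<longleftrightarrow> a = b" for a b :: nat by auto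
  ultimately show ?thesis by simp
qed

text \<open>Multiplication by repeated addition. The only loops run through the whole range below
  register 1, so the second factor is added just as long as the counter is below the first factor;
  the range is long enough because that factor is at most \<open>length w\<close>.\<close>

definition mul_code :: "nat \<Rightarrow> nat \<Rightarrow> cmd" where
  "mul_code x y = block [RConst 5 0] ;;
     For 6 (block [RSub 7 (10 + x) 6, RSub 8 2 7] ;; IfZ 8 (block [RAdd 5 5 (10 + y)]))"

lemma triple_mul_code:
  assumes "x < d" "y < d" "e x \<le> length w"
  shows "triple (poly (1 + ([:1, 1:] * (2 + (1 + 1) + 3) + 1)) (length w)) (ok pres m0 w d e) (mul_code x y)
     (\<lambda>r m. ok pres m0 w d e r m \<and> r 5 = e x * e y)"
proof -
  define I where "I k = (\<lambda>r m. ok pres m0 w d e r m \<and> r 5 = min k (e x) * e y)" for k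
  have 1: "triple (length [RSub 7 (10 + x) 6, RSub 8 2 7] + (length [RAdd 5 5 (10 + y)] + 1)) (\<lambda>r m. I k r m \<and> r 6 = k)
      (block [RSub 7 (10 + x) 6, RSub 8 2 7] ;; IfZ 8 (block [RAdd 5 5 (10 + y)]))
      (\<lambda>r m. r 6 = k \<and> r 1 = Suc (length w) \<and> r 2 = 1 \<and> (\<forall>t. I (Suc k) (r(6 := Suc k, 4 := t)) m))"
      if k: "k < Suc (length w)" for k
  proof (rule triple_seq[OF triple_block triple_ifz[OF triple_block]])
    let ?Q = "\<lambda>r m. I k r m \<and> r 6 = k \<and> r 8 = 1 - (e x - k)"
    show "case_prod ?Q (fold effect [RSub 7 (10 + x) 6, RSub 8 2 7] (r, m))" if "I k r m \<and> r 6 = k" for r m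
      using that assms by (simp add: effect_def I_def, simp add: ok_def)
    show "r 6 = k \<and> r 1 = Suc (length w) \<and> r 2 = 1 \<and> (\<forall>t. I (Suc k) (r(6 := Suc k, 4 := t)) m)"
      if "?Q r m" "r 8 > 0" for r m
      using that by (auto simp: I_def min_def ok_def split: if_splits)
    show "case_prod (\<lambda>r m. r 6 = k \<and> r 1 = Suc (length w) \<and> r 2 = 1 \<and> (\<forall>t. I (Suc k) (r(6 := Suc k, 4 := t)) m))
      (fold effect [RAdd 5 5 (10 + y)] (r, m))" if "?Q r m \<and> r 8 = 0" for r m
    proof -
      have "k < e x" "r (10 + y) = e y" "r 1 = Suc (length w)" "r 2 = 1"
        using that assms by (auto simp: ok_def I_def)
      then show ?thesis using that by (simp add: effect_def I_def min_def)
    qed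
  qed auto
  have "triple (length [RConst 5 0] + (Suc (length w) * (length [RSub 7 (10 + x) 6, RSub 8 2 7] + (length [RAdd 5 5 (10 + y)] + 1) + 3) + 1))
      (ok pres m0 w d e) (mul_code x y) (I (Suc (length w)))"
    unfolding mul_code_def by (rule triple_seq[OF triple_block triple_for[OF 1]]) (auto simp: effect_def I_def)
  then show ?thesis
    by (rule triple_conseq) (use assms in \<open>auto simp: I_def min_def\<close>)
qed

lemma dec_square:
  assumes "x < d"
  shows "dec pres d (\<lambda>w e. e x * e x = length w)"
proof (rule decI)
  fix w :: "bool list" and m0 and e :: "nat \<Rightarrow> nat" assume e: "\<forall>v<d. e v \<le> length w"
  \<comment> \<open>The two truncated differences have sum 0 exactly if the numbers are
    equal.\<close>
  let ?is = "[RSub 6 0 5, RSub 7 5 0, RAdd 6 6 7, RSub 3 2 6]"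
  have "triple (poly (1 + ([:1, 1:] * (2 + (1 + 1) + 3) + 1)) (length w) + length ?is)
      (ok pres m0 w d e) (mul_code x x ;; block ?is)
      (\<lambda>r m. ok pres m0 w d e r m \<and> r 3 = of_bool (e x * e x = length w))"
    by (rule triple_seq, rule triple_mul_code[of x d x e w, OF assms assms e[rule_format, OF assms]], rule triple_block)
       (auto simp: effect_def ok_def)
  then show "triple (poly ((1 + ([:1, 1:] * (2 + (1 + 1) + 3) + 1)) + 4) (length w))
      (ok pres m0 w d e) (mul_code x x ;; block ?is)
      (\<lambda>r m. ok pres m0 w d e r m \<and> r 3 = of_bool (e x * e x = length w))"
    by (simp only: poly_add) simp
qed

lemma dec_bit:
  assumes "x < d" "n < d" "y < d"
  shows "dec pres d (\<lambda>w e. e x * e n + e y < length w \<and> w ! (e x * e n + e y))"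
proof (rule decI)
  fix w :: "bool list" and m0 and e :: "nat \<Rightarrow> nat" assume e: "\<forall>v<d. e v \<le> length w"
  \<comment> \<open>Register 6 becomes 0 iff the address in register 5 lies inside the input. The
    guard keeps the load away from the cells behind the input, which may hold marks.\<close>
  let ?is = "[RAdd 5 5 (10 + y), RSub 6 0 5, RSub 6 2 6, RConst 3 0]"
  let ?c = "mul_code x n ;; block ?is ;; IfZ 6 (block [RLoad 3 5])"
  let ?P = "\<lambda>w e. e x * e n + e y < length w \<and> w ! (e x * e n + e y)"
  have "triple (poly (1 + ([:1, 1:] * (2 + (1 + 1) + 3) + 1)) (length w) + (length ?is + (length [RLoad 3 5] + 1)))
      (ok pres m0 w d e) ?c (\<lambda>r m. ok pres m0 w d e r m \<and> r 3 = of_bool (?P w e))"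
    by (rule triple_seq, rule triple_mul_code[of x d n e w, OF assms(1,2) e[rule_format, OF assms(1)]],
        rule triple_seq[OF triple_block[where Post = "\<lambda>r m. ok pres m0 w d e r m \<and> r 3 = 0 \<and> r 5 = e x * e n + e y
          \<and> r 6 = 1 - (length w - r 5)"] triple_ifz[OF triple_block]])
       (use assms in \<open>auto simp: effect_def ok_def\<close>)
  then show "triple (poly ((1 + ([:1, 1:] * (2 + (1 + 1) + 3) + 1)) + 6) (length w))
      (ok pres m0 w d e) ?c (\<lambda>r m. ok pres m0 w d e r m \<and> r 3 = of_bool (?P w e))"
    by (simp only: poly_add) simp
qed

section \<open>From formulas to decidable languages\<close>

lemma ram_step_halted: "ram_halted P s \<Longrightarrow> (ram_step P ^^ t) s = s"
  by (induction t) (auto simp: ram_step_def)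

lemma polytime_decidableI:
  assumes "dec False 0 (\<lambda>w e. w \<in> L)"
  shows "polytime_decidable L"
proof -
  obtain p c where c: "\<And>w e m0. \<forall>v<0. e v \<le> length w \<Longrightarrow>
     triple (poly p (length w)) (ok False m0 w 0 e) c
       (\<lambda>r m. ok False m0 w 0 e r m \<and> r 3 = of_bool (w \<in> L))"
    by (rule decE[OF assms]) blast
  \<comment> \<open>The prefix puts the constant 1 and the loop bound \<open>length w + 1\<close>
    into registers 2 and 1; the suffix copies the truth value to the verdict register.\<close>
  let ?pre = "[RConst 2 1, RAdd 1 0 2]" and ?post = "[RConst 4 0, RAdd 0 3 4]"
  let ?c = "block ?pre ;; c ;; block ?post"
  have "let s = (ram_step (compile 0 ?c) ^^ poly (2 + (p + 2)) (length w)) (ram_init w) in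
      ram_halted (compile 0 ?c) s \<and> reg s 0 = of_bool (w \<in> L)" for w
  proof -
    have "triple (length ?pre + (poly p (length w) + length ?post)) (\<lambda>r m. r = reg (ram_init w) \<and> m = mem (ram_init w))
       ?c (\<lambda>r m. r 0 = of_bool (w \<in> L))"
      by (rule triple_seq[OF triple_block triple_seq[OF c[of "\<lambda>_. 0" w "\<lambda>_. 0"] triple_block]])
        (auto simp: effect_def ok_def ram_init_def)
    from tripleE[OF this, of "compile 0 ?c" "[]" "[]" "ram_init w"]
    obtain t s where t: "t \<le> length ?pre + (poly p (length w) + length ?post)"
      "(ram_step (compile 0 ?c) ^^ t) (ram_init w) = s" "pc s = csize ?c" "reg s 0 = of_bool (w \<in> L)"
      by (auto simp: ram_init_def)
    have h: "ram_halted (compile 0 ?c) s"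
      using t(3) by (simp add: ram_halted_def)
    have "poly (2 + (p + 2)) (length w) = t + (poly (2 + (p + 2)) (length w) - t)"
      using t(1) by simp
    with funpow_trans[OF t(2) ram_step_halted[OF h]]
    have "(ram_step (compile 0 ?c) ^^ poly (2 + (p + 2)) (length w)) (ram_init w) = s"
      by metis
    with h t(4) show ?thesis by (simp add: Let_def)
  qed
  then show ?thesis
    unfolding polytime_decidable_def ram_decides_within_def by blast
qed

section \<open>Reachability\<close>

abbreviation "okF \<equiv> ok False (\<lambda>_. 0)"

lemma ok_True: "ok True m0 w d e r m \<longleftrightarrow> okF w d e r m \<and> m = m0"
  unfolding ok_def by auto

lemma okF_mem [simp]: "length w \<le> a \<Longrightarrow> okF w d e r (m(a := x)) \<longleftrightarrow> okF w d e r m"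
  unfolding ok_def by auto

lemma ok_var: "ok pres m0 w d e r m \<Longrightarrow> v < d \<Longrightarrow> r (10 + v) = e v"
  unfolding ok_def by auto

text \<open>Introduces a ghost variable: the proof may depend on the initial value \<open>z\<close>
  of the quantity \<open>f\<close>.\<close>

lemma triple_fix:
  assumes "\<And>z. triple T (\<lambda>r m. Pre r m \<and> f r m = z) c Post"
  shows "triple T Pre c Post"
  using assms unfolding triple_def by blast

definition for_time :: "nat poly \<Rightarrow> nat poly" where
  "for_time p = [:1, 1:] * (p + 3) + 1"

lemma triple_for_env:
  assumes "\<And>k. k \<le> length w \<Longrightarrow> triple (poly p (length w))
     (\<lambda>r m. okF w (Suc d) (e(d := k)) r m \<and> J k m) c
     (\<lambda>r m. okF w (Suc d) (e(d := k)) r m \<and> J (Suc k) m)"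
  shows "triple (poly (for_time p) (length w)) (\<lambda>r m. okF w d e r m \<and> J 0 m) (For (10 + d) c)
     (\<lambda>r m. okF w d e r m \<and> J (Suc (length w)) m)"
proof -
  define I where "I k = (\<lambda>r m. okF w d e r m \<and> J k m)" for k
  have 1: "triple (poly p (length w)) (\<lambda>r m. I k r m \<and> r (10 + d) = k) c
      (\<lambda>r m. r (10 + d) = k \<and> r 1 = Suc (length w) \<and> r 2 = 1 \<and> (\<forall>t. I (Suc k) (r(10 + d := Suc k, 4 := t)) m))"
      if k: "k < Suc (length w)" for k
    by (rule triple_conseq[OF assms[of k]]) (use k in \<open>simp_all add: I_def ok_Suc, simp add: ok_def\<close>)
  have "triple (Suc (length w) * (poly p (length w) + 3) + 1)
     (\<lambda>r m. I 0 (r(10 + d := 0)) m) (For (10 + d) c) (I (Suc (length w)))"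
    by (rule triple_for[OF 1]) auto
  then show ?thesis
    by (rule triple_conseq) (simp_all add: I_def for_time_def)
qed

text \<open>
  Vertex \<open>x\<close> counts as visited if memory cell \<open>length w + x\<close> is positive, so that a visit is
  propagated along an edge simply by addition.
\<close>

definition marks :: "bool list \<Rightarrow> (nat \<Rightarrow> nat) \<Rightarrow> nat set" where
  "marks w m = {x. x \<le> length w \<and> m (length w + x) > 0}"

definition rounds :: "('a \<times> 'a) set \<Rightarrow> nat \<Rightarrow> 'a \<Rightarrow> 'a set" where
  "rounds R n s = ((\<lambda>S. S \<union> R `` S) ^^ n) {s}"

lemma rounds_mono: "n \<le> n' \<Longrightarrow> rounds R n s \<subseteq> rounds R n' s"
  unfolding rounds_def by (induction rule: dec_induct) auto

lemma relpow_subset_rounds: "(R ^^ n) `` {s} \<subseteq> rounds R n s"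
proof (induction n)
  case (Suc n)
  have "rounds R (Suc n) s = rounds R n s \<union> R `` rounds R n s"
    by (simp add: rounds_def)
  then show ?case using Suc by auto
qed (simp add: rounds_def)

text \<open>Every reachable vertex is reached by at most \<open>card R\<close> arcs. Counting arcs
  instead of vertices explains why quadratically many rounds are run below.\<close>

lemma rtrancl_subset_rounds:
  assumes "finite R" "card R \<le> n"
  shows "R\<^sup>* `` {s} \<subseteq> rounds R n s"
proof
  fix x assume "x \<in> R\<^sup>* `` {s}"
  then obtain k where "k \<le> card R" "x \<in> (R ^^ k) `` {s}"
    using rtrancl_finite_eq_relpow[OF assms(1)] by auto
  then show "x \<in> rounds R n s"
    using relpow_subset_rounds[of k R s] rounds_mono[of k n R s] assms(2) by auto
qed

context
  fixes w :: "bool list" and d :: nat and e0 :: "nat \<Rightarrow> nat" and B :: cmd and p :: "nat poly"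
    and R :: "(nat \<times> nat) set" and C :: "nat set"
  assumes B: "\<And>e S. \<forall>v<d + 4. e v \<le> length w \<Longrightarrow> \<forall>v<d. e v = e0 v \<Longrightarrow>
      triple (poly p (length w)) (\<lambda>r m. okF w (d + 4) e r m \<and> marks w m = S) B
        (\<lambda>r m. okF w (d + 4) e r m \<and> marks w m = S \<union> {y. y = e (d + 3) \<and> (e (d + 2), y) \<in> R \<and> e (d + 2) \<in> S})"
    and R: "R \<subseteq> {..length w} \<times> {..length w}"
    and C: "R `` C \<subseteq> C"
begin

lemma R_bounded: "(x, y) \<in> R \<Longrightarrow> x \<le> length w \<and> y \<le> length w"
  using R by auto

text \<open>Marks are updated in place, so a vertex marked in the current round may already pass its
  mark on, and no round is computed exactly. The marks are therefore squeezed between what an exact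
  round would yield from its initial set \<open>S\<close> and a set \<open>C\<close> closed under
  \<open>R\<close>.\<close>

lemma triple_row:
  assumes e: "\<forall>v<d + 3. e v \<le> length w" "\<forall>v<d. e v = e0 v" and K: "S \<subseteq> K"
  shows "triple (poly (for_time p) (length w)) (\<lambda>r m. okF w (d + 3) e r m \<and> K \<subseteq> marks w m \<and> marks w m \<subseteq> C)
     (For (10 + (d + 3)) B)
     (\<lambda>r m. okF w (d + 3) e r m \<and> K \<union> {y. (e (d + 2), y) \<in> R \<and> e (d + 2) \<in> S} \<subseteq> marks w m \<and> marks w m \<subseteq> C)"
proof -
  define J where "J k m \<longleftrightarrow> K \<union> {y. y < k \<and> (e (d + 2), y) \<in> R \<and> e (d + 2) \<in> S} \<subseteq> marks w m \<and> marks w m \<subseteq> C" for k m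
  have "triple (poly (for_time p) (length w)) (\<lambda>r m. okF w (d + 3) e r m \<and> J 0 m) (For (10 + (d + 3)) B)
     (\<lambda>r m. okF w (d + 3) e r m \<and> J (Suc (length w)) m)"
  proof (rule triple_for_env)
    fix k assume k: "k \<le> length w"
    have e': "\<forall>v<d + 4. (e(d + 3 := k)) v \<le> length w" "\<forall>v<d. (e(d + 3 := k)) v = e0 v"
      using e k by auto
    have [simp]: "Suc (d + 3) = d + 4" by simp
    show "triple (poly p (length w)) (\<lambda>r m. okF w (Suc (d + 3)) (e(d + 3 := k)) r m \<and> J k m) B
      (\<lambda>r m. okF w (Suc (d + 3)) (e(d + 3 := k)) r m \<and> J (Suc k) m)"
    proof (rule triple_fix[where f = "\<lambda>r m. marks w m"])
      fix T
      show "triple (poly p (length w)) (\<lambda>r m. (okF w (Suc (d + 3)) (e(d + 3 := k)) r m \<and> J k m) \<and> marks w m = T) B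
        (\<lambda>r m. okF w (Suc (d + 3)) (e(d + 3 := k)) r m \<and> J (Suc k) m)"
      proof (cases "K \<union> {y. y < k \<and> (e (d + 2), y) \<in> R \<and> e (d + 2) \<in> S} \<subseteq> T \<and> T \<subseteq> C")
        case True
        have "J (Suc k) m" if "marks w m = T \<union> {y. y = k \<and> (e (d + 2), y) \<in> R \<and> e (d + 2) \<in> T}" for m
          unfolding J_def that using True K C by (auto simp: less_Suc_eq) (blast)+
        then show ?thesis
          by (intro triple_conseq[OF B[of "e(d + 3 := k)", OF e', of T]]) simp_all
      qed (rule triple_vacuous, auto simp: J_def)
    qed
  qed
  then show ?thesis
    by (rule triple_conseq) (use R_bounded in \<open>auto simp: J_def less_Suc_eq_le\<close>)
qed

lemma triple_round:
  assumes e: "\<forall>v<d + 2. e v \<le> length w" "\<forall>v<d. e v = e0 v"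
  shows "triple (poly (for_time (for_time p)) (length w)) (\<lambda>r m. okF w (d + 2) e r m \<and> S \<subseteq> marks w m \<and> marks w m \<subseteq> C)
     (For (10 + (d + 2)) (For (10 + (d + 3)) B))
     (\<lambda>r m. okF w (d + 2) e r m \<and> S \<union> R `` S \<subseteq> marks w m \<and> marks w m \<subseteq> C)"
proof -
  define K where "K k = S \<union> {y. \<exists>x<k. (x, y) \<in> R \<and> x \<in> S}" for k
  have "triple (poly (for_time (for_time p)) (length w)) (\<lambda>r m. okF w (d + 2) e r m \<and> K 0 \<subseteq> marks w m \<and> marks w m \<subseteq> C)
     (For (10 + (d + 2)) (For (10 + (d + 3)) B))
     (\<lambda>r m. okF w (d + 2) e r m \<and> K (Suc (length w)) \<subseteq> marks w m \<and> marks w m \<subseteq> C)"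
  proof (rule triple_for_env)
    fix k assume k: "k \<le> length w"
    have e': "\<forall>v<d + 3. (e(d + 2 := k)) v \<le> length w" "\<forall>v<d. (e(d + 2 := k)) v = e0 v"
      using e k by auto
    have [simp]: "Suc (d + 2) = d + 3" by simp
    have KS: "K k \<union> {y. (k, y) \<in> R \<and> k \<in> S} = K (Suc k)"
      unfolding K_def by (auto simp: less_Suc_eq)
    show "triple (poly (for_time p) (length w)) (\<lambda>r m. okF w (Suc (d + 2)) (e(d + 2 := k)) r m \<and> K k \<subseteq> marks w m \<and> marks w m \<subseteq> C)
      (For (10 + (d + 3)) B)
      (\<lambda>r m. okF w (Suc (d + 2)) (e(d + 2 := k)) r m \<and> K (Suc k) \<subseteq> marks w m \<and> marks w m \<subseteq> C)"
      using triple_row[of "e(d + 2 := k)", OF e', of S "K k"] unfolding KS[symmetric]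
      by (simp only: fun_upd_same \<open>Suc (d + 2) = d + 3\<close>) (simp add: K_def)
  qed
  moreover have "K 0 = S" "K (Suc (length w)) = S \<union> R `` S"
    using R by (auto simp: K_def less_Suc_eq_le)
  ultimately show ?thesis by simp
qed

text \<open>The two outer loops merely count. They provide \<open>?M * ?M\<close> rounds, at least
  as many as there are arcs in \<open>R\<close>.\<close>

lemma triple_rounds:
  assumes e: "\<forall>v<d. e v \<le> length w" "\<forall>v<d. e v = e0 v"
  shows "triple (poly (for_time (for_time (for_time (for_time p)))) (length w))
     (\<lambda>r m. okF w d e r m \<and> {s} \<subseteq> marks w m \<and> marks w m \<subseteq> C)
     (For (10 + d) (For (10 + (d + 1)) (For (10 + (d + 2)) (For (10 + (d + 3)) B))))
     (\<lambda>r m. okF w d e r m \<and> R\<^sup>* `` {s} \<subseteq> marks w m \<and> marks w m \<subseteq> C)"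
proof -
  let ?M = "Suc (length w)"
  have "triple (poly (for_time (for_time (for_time (for_time p)))) (length w))
     (\<lambda>r m. okF w d e r m \<and> rounds R (0 * ?M) s \<subseteq> marks w m \<and> marks w m \<subseteq> C)
     (For (10 + d) (For (10 + (d + 1)) (For (10 + (d + 2)) (For (10 + (d + 3)) B))))
     (\<lambda>r m. okF w d e r m \<and> rounds R (?M * ?M) s \<subseteq> marks w m \<and> marks w m \<subseteq> C)"
  proof (rule triple_for_env)
    fix i assume i: "i \<le> length w"
    have eqs: "i * ?M + 0 = i * ?M" "i * ?M + ?M = Suc i * ?M" "Suc d = d + 1"
      by simp_all
    have "triple (poly (for_time (for_time (for_time p))) (length w))
       (\<lambda>r m. okF w (Suc d) (e(d := i)) r m \<and> rounds R (i * ?M + 0) s \<subseteq> marks w m \<and> marks w m \<subseteq> C)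
       (For (10 + Suc d) (For (10 + (d + 2)) (For (10 + (d + 3)) B)))
       (\<lambda>r m. okF w (Suc d) (e(d := i)) r m \<and> rounds R (i * ?M + ?M) s \<subseteq> marks w m \<and> marks w m \<subseteq> C)"
    proof (rule triple_for_env)
      fix j assume j: "j \<le> length w"
      have e': "\<forall>v<d + 2. (e(d := i, Suc d := j)) v \<le> length w" "\<forall>v<d. (e(d := i, Suc d := j)) v = e0 v"
        using e i j by auto
      have S: "rounds R (i * ?M + j) s \<union> R `` rounds R (i * ?M + j) s = rounds R (i * ?M + Suc j) s"
        by (simp add: rounds_def)
      show "triple (poly (for_time (for_time p)) (length w))
       (\<lambda>r m. okF w (Suc (Suc d)) (e(d := i, Suc d := j)) r m \<and> rounds R (i * ?M + j) s \<subseteq> marks w m \<and> marks w m \<subseteq> C)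
       (For (10 + (d + 2)) (For (10 + (d + 3)) B))
       (\<lambda>r m. okF w (Suc (Suc d)) (e(d := i, Suc d := j)) r m \<and> rounds R (i * ?M + Suc j) s \<subseteq> marks w m \<and> marks w m \<subseteq> C)"
        using triple_round[of "e(d := i, Suc d := j)", OF e', of "rounds R (i * ?M + j) s"] unfolding S by simp
    qed
    then show "triple (poly (for_time (for_time (for_time p))) (length w))
       (\<lambda>r m. okF w (Suc d) (e(d := i)) r m \<and> rounds R (i * ?M) s \<subseteq> marks w m \<and> marks w m \<subseteq> C)
       (For (10 + (d + 1)) (For (10 + (d + 2)) (For (10 + (d + 3)) B)))
       (\<lambda>r m. okF w (Suc d) (e(d := i)) r m \<and> rounds R (Suc i * ?M) s \<subseteq> marks w m \<and> marks w m \<subseteq> C)"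
      by (simp only: eqs)
  qed
  moreover have "R\<^sup>* `` {s} \<subseteq> rounds R (?M * ?M) s"
  proof (rule rtrancl_subset_rounds)
    show "finite R" using finite_subset[OF R] by simp
    show "card R \<le> ?M * ?M" using card_mono[OF _ R] by simp
  qed
  ultimately show ?thesis
    by (elim triple_conseq) (auto simp: rounds_def)
qed

end

text \<open>The code for \<open>R\<close> runs while the marks are in memory and must leave them
  alone, hence \<open>dec True\<close>; the search itself overwrites the memory, hence
  \<open>dec False\<close> in the conclusion and no search inside a search. Variables
  \<open>d\<close> and \<open>d + 1\<close> count rounds, \<open>d + 2\<close> and
  \<open>d + 3\<close> are the ends of the pair under inspection, so \<open>R\<close> may depend
  only on the variables below \<open>d\<close>.\<close>

lemma dec_reach:
  assumes R: "dec True (d + 4) (\<lambda>w e. R w e (e (d + 2)) (e (d + 3)))"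
    and cong: "\<And>w e e'. \<forall>v<d. e v = e' v \<Longrightarrow> R w e = R w e'"
    and st: "s < d" "t < d"
  shows "dec False d (\<lambda>w e. (e s, e t) \<in> {(x, y). x \<le> length w \<and> y \<le> length w \<and> R w e x y}\<^sup>*)"
proof -
  obtain p c where c: "\<And>w e m0. \<forall>v<d + 4. e v \<le> length w \<Longrightarrow>
     triple (poly p (length w)) (ok True m0 w (d + 4) e) c
       (\<lambda>r m. ok True m0 w (d + 4) e r m \<and> r 3 = of_bool (R w e (e (d + 2)) (e (d + 3))))"
    by (rule decE[OF R]) blast
  let ?is = "[RAdd 5 0 (10 + (d + 2)), RLoad 6 5, RAdd 5 0 (10 + (d + 3)), RLoad 7 5, RAdd 7 7 6, RStore 5 7]"
  define B where "B = c ;; block [RSub 3 2 3] ;; IfZ 3 (block ?is)"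
  let ?E = "\<lambda>w e. {(x, y). x \<le> length w \<and> y \<le> length w \<and> R w e x y}"
  have B: "triple (poly (p + (1 + (6 + 1))) (length w)) (\<lambda>r m. okF w (d + 4) e r m \<and> marks w m = S) B
        (\<lambda>r m. okF w (d + 4) e r m \<and> marks w m = S \<union> {y. y = e (d + 3) \<and> (e (d + 2), y) \<in> ?E w e0 \<and> e (d + 2) \<in> S})"
    if e: "\<forall>v<d + 4. e v \<le> length w" and e0: "\<forall>v<d. e v = e0 v" for e e0 :: "nat \<Rightarrow> nat" and w S
  proof (rule triple_fix[where f = "\<lambda>r m. m"])
    \<comment> \<open>The current memory is frozen as \<open>m0\<close>, so that the code for
      \<open>R\<close> is known to return it unchanged.\<close>
    fix m0
    let ?Q = "\<lambda>r m. okF w (d + 4) e r m \<and> marks w m = S \<union> {y. y = e (d + 3) \<and> (e (d + 2), y) \<in> ?E w e0 \<and> e (d + 2) \<in> S}"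
    have Re: "R w e = R w e0" using cong e0 by blast
    have le: "e (d + 2) \<le> length w" "e (d + 3) \<le> length w" using e by auto
    show "triple (poly (p + (1 + (6 + 1))) (length w)) (\<lambda>r m. (okF w (d + 4) e r m \<and> marks w m = S) \<and> m = m0) B ?Q"
    proof (cases "marks w m0 = S")
      case S: True
      have "triple (poly p (length w) + (length [RSub 3 2 3] + (length ?is + 1))) (ok True m0 w (d + 4) e) B ?Q"
        unfolding B_def
      proof (rule triple_seq[OF c[OF e]], rule triple_seq[OF triple_block triple_ifz[OF triple_block]])
        let ?P = "\<lambda>r m. okF w (d + 4) e r m \<and> m = m0 \<and> r 3 = of_bool (\<not> R w e0 (e (d + 2)) (e (d + 3)))"
        show "case_prod ?P (fold effect [RSub 3 2 3] (r, m))"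
          if "ok True m0 w (d + 4) e r m \<and> r 3 = of_bool (R w e (e (d + 2)) (e (d + 3)))" for r m
          using that by (simp add: effect_def ok_True Re, simp add: ok_def)
        show "?Q r m" if "?P r m" "r 3 > 0" for r m
          using that S by auto
        show "case_prod ?Q (fold effect ?is (r, m))" if "?P r m \<and> r 3 = 0" for r m
        proof -
          have r: "okF w (d + 4) e r m" "m = m0" "R w e0 (e (d + 2)) (e (d + 3))"
            "r 0 = length w" "r (10 + (d + 2)) = e (d + 2)" "r (10 + (d + 3)) = e (d + 3)"
            using that ok_var[of False _ w "d + 4" e r m "d + 2"] ok_var[of False _ w "d + 4" e r m "d + 3"]
            by (auto simp: ok_def)
          have "marks w (m0(length w + e (d + 3) := m0 (length w + e (d + 3)) + m0 (length w + e (d + 2)))) =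
              S \<union> {y. y = e (d + 3) \<and> e (d + 2) \<in> S}"
            using le S by (auto simp: marks_def)
          then show ?thesis using r le by (auto simp: effect_def)
        qed
      qed auto
      then show ?thesis
        by (rule triple_conseq) (auto simp: ok_True)
    qed (rule triple_vacuous, auto)
  qed
  let ?i1 = "[RAdd 5 0 (10 + d), RConst 6 0, RStore 5 6]" and ?i2 = "[RAdd 5 0 (10 + s), RStore 5 2]"
    and ?i3 = "[RAdd 5 0 (10 + t), RLoad 6 5, RSub 6 2 6, RSub 3 2 6]"
  let ?B = "For (10 + d) (For (10 + (d + 1)) (For (10 + (d + 2)) (For (10 + (d + 3)) B)))"
  let ?p = "for_time (for_time (for_time (for_time (p + (1 + (6 + 1))))))"
  let ?c = "For (10 + d) (block ?i1) ;; block ?i2 ;; ?B ;; block ?i3"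
  show ?thesis
  proof (rule decI)
    fix w :: "bool list" and m0 and e :: "nat \<Rightarrow> nat" assume e: "\<forall>v<d. e v \<le> length w"
    let ?R = "?E w e"
    let ?C = "?R\<^sup>* `` {e s}"
    \<comment> \<open>Earlier searches may have left marks behind the input; they are cleared
      first.\<close>
    have c1: "triple (poly (for_time 3) (length w)) (\<lambda>r m. okF w d e r m \<and> (\<forall>x<0. m (length w + x) = 0)) (For (10 + d) (block ?i1))
       (\<lambda>r m. okF w d e r m \<and> (\<forall>x<Suc (length w). m (length w + x) = 0))"
    proof (rule triple_for_env)
      fix k assume "k \<le> length w"
      have "triple (length ?i1) (\<lambda>r m. okF w (Suc d) (e(d := k)) r m \<and> (\<forall>x<k. m (length w + x) = 0)) (block ?i1)
         (\<lambda>r m. okF w (Suc d) (e(d := k)) r m \<and> (\<forall>x<Suc k. m (length w + x) = 0))"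
      proof (rule triple_block)
        fix r m assume A: "okF w (Suc d) (e(d := k)) r m \<and> (\<forall>x<k. m (length w + x) = 0)"
        then have "r 0 = length w" "r (10 + d) = k" by (auto simp: ok_def)
        with A show "case_prod (\<lambda>r m. okF w (Suc d) (e(d := k)) r m \<and> (\<forall>x<Suc k. m (length w + x) = 0)) (fold effect ?i1 (r, m))"
          by (auto simp: effect_def less_Suc_eq)
      qed auto
      then show "triple (poly 3 (length w)) (\<lambda>r m. okF w (Suc d) (e(d := k)) r m \<and> (\<forall>x<k. m (length w + x) = 0)) (block ?i1)
         (\<lambda>r m. okF w (Suc d) (e(d := k)) r m \<and> (\<forall>x<Suc k. m (length w + x) = 0))"
        by (rule triple_conseq) simp_all
    qed
    have c2: "triple (length ?i2) (\<lambda>r m. okF w d e r m \<and> (\<forall>x<Suc (length w). m (length w + x) = 0)) (block ?i2)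
       (\<lambda>r m. okF w d e r m \<and> {e s} \<subseteq> marks w m \<and> marks w m \<subseteq> ?C)"
    proof (rule triple_block)
      fix r m assume A: "okF w d e r m \<and> (\<forall>x<Suc (length w). m (length w + x) = 0)"
      then have r: "r 0 = length w" "r (10 + s) = e s" "r 2 = 1" using st by (auto simp: ok_def)
      have "marks w (m(length w + e s := 1)) = {e s}"
        using A e st by (auto simp: marks_def less_Suc_eq_le)
      then show "case_prod (\<lambda>r m. okF w d e r m \<and> {e s} \<subseteq> marks w m \<and> marks w m \<subseteq> ?C) (fold effect ?i2 (r, m))"
        using A r by (simp add: effect_def)
    qed auto
    have c3: "triple (poly ?p (length w)) (\<lambda>r m. okF w d e r m \<and> {e s} \<subseteq> marks w m \<and> marks w m \<subseteq> ?C) ?B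
      (\<lambda>r m. okF w d e r m \<and> ?R\<^sup>* `` {e s} \<subseteq> marks w m \<and> marks w m \<subseteq> ?C)"
      by (rule triple_rounds[where R = ?R and e0 = e, OF B _ _ e]) (auto intro: rtrancl_into_rtrancl)
    have c4: "triple (length ?i3) (\<lambda>r m. okF w d e r m \<and> ?R\<^sup>* `` {e s} \<subseteq> marks w m \<and> marks w m \<subseteq> ?C) (block ?i3)
      (\<lambda>r m. okF w d e r m \<and> r 3 = of_bool ((e s, e t) \<in> ?R\<^sup>*))"
    proof (rule triple_block)
      fix r m assume A: "okF w d e r m \<and> ?R\<^sup>* `` {e s} \<subseteq> marks w m \<and> marks w m \<subseteq> ?C"
      then have r: "r 0 = length w" "r (10 + t) = e t" "r 2 = 1" using st by (auto simp: ok_def)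
      \<comment> \<open>With the reachable set itself as the closed set \<open>C\<close>, the lower
        and the upper bound for the marks coincide.\<close>
      have "marks w m = ?C" using A by blast
      then have "m (length w + e t) > 0 \<longleftrightarrow> (e s, e t) \<in> ?R\<^sup>*"
        using e st unfolding marks_def by blast
      then have "1 - (1 - m (length w + e t)) = of_bool ((e s, e t) \<in> ?R\<^sup>*)"
        by (cases "(e s, e t) \<in> ?R\<^sup>*") auto
      then show "case_prod (\<lambda>r m. okF w d e r m \<and> r 3 = of_bool ((e s, e t) \<in> ?R\<^sup>*)) (fold effect ?i3 (r, m))"
        using A r by (simp add: effect_def del: of_bool_eq_iff)
    qed auto
    have "triple (poly (for_time 3) (length w) + (length ?i2 + (poly ?p (length w) + length ?i3)))
       (\<lambda>r m. okF w d e r m \<and> (\<forall>x<0. m (length w + x) = 0)) ?c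
       (\<lambda>r m. okF w d e r m \<and> r 3 = of_bool ((e s, e t) \<in> ?R\<^sup>*))"
      by (intro triple_seq[OF c1] triple_seq[OF c2] triple_seq[OF c3 c4])
    then show "triple (poly (for_time 3 + (2 + (?p + 4))) (length w)) (ok False m0 w d e) ?c
       (\<lambda>r m. ok False m0 w d e r m \<and> r 3 = of_bool ((e s, e t) \<in> ?R\<^sup>*))"
      by (rule triple_conseq) (simp_all add: ok_def)
  qed
qed

section \<open>Induced minors as systems of bags\<close>

text \<open>Connectivity within \<open>S\<close>. The empty set counts as connected, so bags are
  required to be non-empty separately.\<close>

definition conn :: "('a \<times> 'a) set \<Rightarrow> 'a set \<Rightarrow> bool" where
  "conn E S \<longleftrightarrow> (\<forall>x\<in>S. \<forall>y\<in>S. (x, y) \<in> (E \<inter> S \<times> S)\<^sup>*)"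

definition touches :: "('a \<times> 'a) set \<Rightarrow> 'a set \<Rightarrow> 'a set \<Rightarrow> bool" where
  "touches E S T \<longleftrightarrow> (\<exists>x\<in>S. \<exists>y\<in>T. (x, y) \<in> E)"

definition minor_model :: "'a pair_pre_digraph \<Rightarrow> 'b pair_pre_digraph \<Rightarrow> ('b \<Rightarrow> 'a set) \<Rightarrow> bool" where
  "minor_model G H B \<longleftrightarrow>
     (\<forall>h\<in>pverts H. B h \<noteq> {} \<and> B h \<subseteq> pverts G \<and> conn (parcs G) (B h)) \<and>
     (\<forall>h\<in>pverts H. \<forall>k\<in>pverts H. h \<noteq> k \<longrightarrow>
        B h \<inter> B k = {} \<and> (touches (parcs G) (B h) (B k) \<longleftrightarrow> (h, k) \<in> parcs H))"

lemma pair_graph_arc: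
  assumes "pair_graph G" "(x, y) \<in> parcs G"
  shows "x \<in> pverts G" "y \<in> pverts G" "x \<noteq> y" "(y, x) \<in> parcs G"
proof -
  interpret pair_graph G by fact
  show "x \<in> pverts G" "y \<in> pverts G" "(y, x) \<in> parcs G"
    using assms(2) in_arcsD1 in_arcsD2 arcs_symmetric by auto
  show "x \<noteq> y" using assms(2) pair_no_loops by fastforce
qed

text \<open>A digraph isomorphism carries its own map on arcs. Tails and heads are the projections
  on both sides, so that map is forced by the vertex map.\<close>

lemma digraph_iso_with_proj:
  assumes "pair_graph G"
  shows "digraph_iso (with_proj G) (with_proj H) \<longleftrightarrow>
     (\<exists>f. inj_on f (pverts G) \<and> pverts H = f ` pverts G \<and> parcs H = map_prod f f ` parcs G)"
    (is "?L \<longleftrightarrow> ?R")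
proof -
  interpret pair_graph G by fact
  show ?thesis
  proof
    assume ?L
    then obtain i where i: "pre_digraph.digraph_isomorphism (with_proj G) i" "with_proj H = app_iso i (with_proj G)"
      unfolding digraph_iso_def by blast
    have 1: "pverts H = iso_verts i ` pverts G" "parcs H = iso_arcs i ` parcs G" "fst = iso_tail i" "snd = iso_head i"
      using i(2) by (auto simp: app_iso_def with_proj_def)
    have "iso_arcs i a = map_prod (iso_verts i) (iso_verts i) a" if "a \<in> parcs G" for a
      using i(1) that 1(3,4) unfolding pre_digraph.digraph_isomorphism_def by (auto simp: prod_eq_iff)
    then have "parcs H = map_prod (iso_verts i) (iso_verts i) ` parcs G"
      using 1(2) by auto
    moreover have "inj_on (iso_verts i) (pverts G)"
      using i(1) unfolding pre_digraph.digraph_isomorphism_def by simp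
    ultimately show ?R using 1(1) by blast
  next
    assume ?R
    then obtain f where f: "inj_on f (pverts G)" "pverts H = f ` pverts G" "parcs H = map_prod f f ` parcs G"
      by blast
    define i where "i = \<lparr>iso_verts = f, iso_arcs = map_prod f f, iso_head = snd, iso_tail = fst\<rparr>"
    have "inj_on (map_prod f f) (parcs G)"
      using f(1) in_arcsD1 in_arcsD2 by (auto simp: inj_on_def)
    then have "pre_digraph.digraph_isomorphism (with_proj G) i"
      using f(1) wf_digraph unfolding pre_digraph.digraph_isomorphism_def i_def by auto
    moreover have "with_proj H = app_iso i (with_proj G)"
      using f by (auto simp: app_iso_def i_def with_proj_def)
    ultimately show ?L unfolding digraph_iso_def by blast
  qed
qed

lemma minor_model_iso:
  assumes "pair_graph G" "digraph_iso (with_proj G) (with_proj H)"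
  shows "\<exists>B. minor_model G H B"
proof -
  interpret pair_graph G by fact
  obtain f where f: "inj_on f (pverts G)" "pverts H = f ` pverts G" "parcs H = map_prod f f ` parcs G"
    using assms(2) unfolding digraph_iso_with_proj[OF assms(1)] by blast
  have "minor_model G H (\<lambda>h. {x \<in> pverts G. f x = h})"
    unfolding minor_model_def
  proof (intro conjI ballI impI)
    fix h k assume "h \<in> pverts H" "k \<in> pverts H" "h \<noteq> k"
    show "touches (parcs G) {x \<in> pverts G. f x = h} {x \<in> pverts G. f x = k} \<longleftrightarrow> (h, k) \<in> parcs H"
    proof
      assume "(h, k) \<in> parcs H"
      then obtain x y where "(x, y) \<in> parcs G" "h = f x" "k = f y" unfolding f(3) by auto
      then show "touches (parcs G) {x \<in> pverts G. f x = h} {x \<in> pverts G. f x = k}"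
        unfolding touches_def using in_arcsD1[of x y] in_arcsD2[of x y]
        by (intro bexI[of _ x] bexI[of _ y]) simp_all
    next
      assume "touches (parcs G) {x \<in> pverts G. f x = h} {x \<in> pverts G. f x = k}"
      then show "(h, k) \<in> parcs H" unfolding touches_def f(3) by (auto intro!: image_eqI)
    qed
  next
    fix h
    have "x = y" if "x \<in> pverts G" "y \<in> pverts G" "f x = f y" for x y
      using f(1) that by (auto dest: inj_onD)
    then show "conn (parcs G) {x \<in> pverts G. f x = h}"
      unfolding conn_def by auto
  next
    fix h assume "h \<in> pverts H"
    then show "{x \<in> pverts G. f x = h} \<noteq> {}" unfolding f(2) by auto
  qed blast+
  then show ?thesis by blast
qed

lemma conn_mono: "conn E S \<Longrightarrow> E \<inter> S \<times> S \<subseteq> E' \<Longrightarrow> conn E' S"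
  unfolding conn_def using rtrancl_mono[of "E \<inter> S \<times> S" "E' \<inter> S \<times> S"] by blast

lemma pair_contract_simps:
  "pverts (pair_contract u v G) = id(v := u) ` pverts G"
  "parcs (pair_contract u v G) = map_prod (id(v := u)) (id(v := u)) ` parcs G - Id"
  by (simp_all add: pair_contract_def Let_def)

text \<open>Steps can be undone on the level of bags: a deletion leaves them as they are, a
  contraction replaces them by their preimages.\<close>

lemma minor_model_step:
  assumes "induced_minor_step G G'" "pair_graph G" "minor_model G' H B'"
  shows "\<exists>B. minor_model G H B"
  using assms(1)
proof cases
  case (delete v)
  have "minor_model G H B'"
    unfolding minor_model_def
  proof (intro conjI ballI impI)
    fix h assume h: "h \<in> pverts H"
    then show "B' h \<noteq> {}" "B' h \<subseteq> pverts G"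
      using assms(3) unfolding minor_model_def delete by (auto simp: pair_del_vert_def)
    show "conn (parcs G) (B' h)"
      by (rule conn_mono[of "parcs G'"]) (use assms(3) h in \<open>auto simp: minor_model_def delete pair_del_vert_def\<close>)
  next
    fix h k assume hk: "h \<in> pverts H" "k \<in> pverts H" "h \<noteq> k"
    then show "B' h \<inter> B' k = {}" using assms(3) unfolding minor_model_def by blast
    have "v \<notin> B' h" "v \<notin> B' k"
      using assms(3) hk unfolding minor_model_def delete by (auto simp: pair_del_vert_def)
    then have "touches (parcs G) (B' h) (B' k) \<longleftrightarrow> touches (parcs G') (B' h) (B' k)"
      unfolding touches_def delete pair_del_vert_def by auto
    then show "touches (parcs G) (B' h) (B' k) \<longleftrightarrow> (h, k) \<in> parcs H"
      using assms(3) hk unfolding minor_model_def by blast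
  qed
  then show ?thesis by blast
next
  case (contract u v)
  interpret pair_graph G by fact
  define r where "r = id(v := u)"
  have uv: "u \<in> pverts G" "v \<in> pverts G" "u \<noteq> v" "(v, u) \<in> parcs G"
    using pair_graph_arc[OF assms(2) contract(2)] by simp_all
  have V': "pverts G' = r ` pverts G" and E': "parcs G' = map_prod r r ` parcs G - Id"
    unfolding contract r_def by (simp_all add: pair_contract_simps)
  define B where "B h = {x \<in> pverts G. r x \<in> B' h}" for h
  have "minor_model G H B"
    unfolding minor_model_def
  proof (intro conjI ballI impI)
    fix h assume h: "h \<in> pverts H"
    then have B': "B' h \<noteq> {}" "B' h \<subseteq> r ` pverts G" "conn (parcs G') (B' h)"
      using assms(3) unfolding minor_model_def V' by auto
    show "B h \<noteq> {}" "B h \<subseteq> pverts G" using B' unfolding B_def by auto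
    let ?E = "parcs G \<inter> B h \<times> B h"
    \<comment> \<open>A preimage containing \<open>v\<close> also contains \<open>u\<close>, and the
      two are adjacent; so every vertex is connected to its image inside the preimage.\<close>
    have rr: "(x, r x) \<in> ?E\<^sup>* \<and> (r x, x) \<in> ?E\<^sup>*" if "x \<in> B h" for x
      using that uv contract(2) by (cases "x = v") (auto simp: r_def B_def intro!: r_into_rtrancl)
    have step: "(a, b) \<in> ?E\<^sup>*" if "(a, b) \<in> parcs G' \<inter> B' h \<times> B' h" for a b
    proof -
      obtain p q where pq: "(p, q) \<in> parcs G" "a = r p" "b = r q"
        using \<open>(a, b) \<in> parcs G' \<inter> B' h \<times> B' h\<close> unfolding E' by auto
      then have "p \<in> B h" "q \<in> B h"
        using that in_arcsD1 in_arcsD2 unfolding B_def by auto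
      then have "(p, q) \<in> ?E\<^sup>*" "(r p, p) \<in> ?E\<^sup>*" "(q, r q) \<in> ?E\<^sup>*"
        using pq(1) rr by auto
      then show ?thesis unfolding pq(2,3) by (meson rtrancl_trans)
    qed
    have "(a, b) \<in> ?E\<^sup>*" if "(a, b) \<in> (parcs G' \<inter> B' h \<times> B' h)\<^sup>*" for a b
      using that by induction (auto intro: step rtrancl_trans)
    then show "conn (parcs G) (B h)"
      using B'(3) rr unfolding conn_def by (metis (no_types, lifting) B_def mem_Collect_eq rtrancl_trans)
  next
    fix h k assume hk: "h \<in> pverts H" "k \<in> pverts H" "h \<noteq> k"
    then have B': "B' h \<inter> B' k = {}" "touches (parcs G') (B' h) (B' k) \<longleftrightarrow> (h, k) \<in> parcs H"
      using assms(3) unfolding minor_model_def by blast+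
    then show "B h \<inter> B k = {}" unfolding B_def by auto
    have "touches (parcs G) (B h) (B k) \<longleftrightarrow> touches (parcs G') (B' h) (B' k)"
    proof
      assume "touches (parcs G) (B h) (B k)"
      then obtain x y where "(x, y) \<in> parcs G" "r x \<in> B' h" "r y \<in> B' k"
        unfolding touches_def B_def by auto
      then show "touches (parcs G') (B' h) (B' k)"
        unfolding touches_def E' using B'(1) by (intro bexI[of _ "r x"] bexI[of _ "r y"]) auto
    next
      assume "touches (parcs G') (B' h) (B' k)"
      then obtain x y where xy: "(x, y) \<in> parcs G" "r x \<in> B' h" "r y \<in> B' k"
        unfolding touches_def E' by auto
      then show "touches (parcs G) (B h) (B k)"
        unfolding touches_def B_def using pair_graph_arc(1,2)[OF assms(2) xy(1)]
        by (intro bexI[of _ x] bexI[of _ y]) simp_all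
    qed
    with B' show "touches (parcs G) (B h) (B k) \<longleftrightarrow> (h, k) \<in> parcs H" by simp
  qed
  then show ?thesis by blast
qed

lemma minor_model_if_contains:
  assumes "pair_graph G" "contains_induced_minor G H"
  shows "\<exists>B. minor_model G H B"
proof -
  obtain G' where G': "induced_minor_step\<^sup>*\<^sup>* G G'" "digraph_iso (with_proj G') (with_proj H)"
    using assms(2) unfolding contains_induced_minor_def by blast
  from G'(1) assms(1) show ?thesis
  proof (induction rule: converse_rtranclp_induct)
    case base
    then show ?case using minor_model_iso G'(2) by blast
  next
    case (step G1 G2)
    then show ?case using minor_model_step pair_graph_induced_minor_step by blast
  qed
qed

section \<open>From bag systems back to induced minors\<close>

lemma conn_map:
  assumes "conn E S" "map_prod r r ` E \<subseteq> E' \<union> Id"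
  shows "conn E' (r ` S)"
proof -
  have "(r x, r y) \<in> (E' \<inter> r ` S \<times> r ` S)\<^sup>*" if "(x, y) \<in> (E \<inter> S \<times> S)\<^sup>*" for x y
    using that
  proof induction
    case (step y z)
    have "(r y, r z) \<in> E' \<union> Id" using step(2) assms(2) by force
    then show ?case using step(2,3) by (auto intro: rtrancl_into_rtrancl)
  qed simp
  then show ?thesis using assms(1) unfolding conn_def by auto
qed

text \<open>Induction on the number of vertices. A vertex outside all bags is deleted, an edge
  inside a bag is contracted. If neither exists, the bags are singletons covering the graph, and
  sending each vertex to the index of its bag is an isomorphism.\<close>

lemma contains_if_minor_model:
  assumes "pair_graph G" "pair_graph H" "minor_model G H B"
  shows "contains_induced_minor G H"
  using assms(1,3)
proof (induction "card (pverts G)" arbitrary: G B rule: less_induct)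
  case less
  interpret G: pair_graph G by fact
  interpret H: pair_graph H by fact
  have B: "B h \<noteq> {}" "B h \<subseteq> pverts G" "conn (parcs G) (B h)" if "h \<in> pverts H" for h
    using less.prems(2) that unfolding minor_model_def by blast+
  have BB: "B h \<inter> B k = {}" "touches (parcs G) (B h) (B k) \<longleftrightarrow> (h, k) \<in> parcs H"
    if "h \<in> pverts H" "k \<in> pverts H" "h \<noteq> k" for h k
    using less.prems(2) that unfolding minor_model_def by blast+
  have step: "contains_induced_minor G H"
    if "induced_minor_step G G'" "card (pverts G') < card (pverts G)" "minor_model G' H B'" for G' B'
  proof -
    have "contains_induced_minor G' H"
      using less.hyps[OF that(2) pair_graph_induced_minor_step[OF that(1) less.prems(1)] that(3)] .
    then show ?thesis
      using that(1) unfolding contains_induced_minor_def by (meson converse_rtranclp_into_rtranclp)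
  qed
  consider (out) v where "v \<in> pverts G" "\<forall>h\<in>pverts H. v \<notin> B h"
    | (big) h x y where "h \<in> pverts H" "x \<in> B h" "y \<in> B h" "x \<noteq> y"
    | (single) "\<forall>v\<in>pverts G. \<exists>h\<in>pverts H. v \<in> B h" "\<forall>h\<in>pverts H. \<forall>x\<in>B h. \<forall>y\<in>B h. x = y"
    by blast
  then show ?case
  proof cases
    case out
    show ?thesis
    proof (rule step[OF induced_minor_step.delete[OF out(1)]])
      show "card (pverts (pair_del_vert v G)) < card (pverts G)"
        using out(1) G.pair_finite_verts by (simp add: pair_del_vert_def card_Diff1_less del: card_Diff_insert card_Diff_singleton)
      show "minor_model (pair_del_vert v G) H B"
        unfolding minor_model_def
      proof (intro conjI ballI impI)
        fix h assume h: "h \<in> pverts H"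
        show "B h \<noteq> {}" "B h \<subseteq> pverts (pair_del_vert v G)"
          using B[OF h] out(2) h by (auto simp: pair_del_vert_def)
        show "conn (parcs (pair_del_vert v G)) (B h)"
          by (rule conn_mono[OF B(3)[OF h]]) (use out(2) h in \<open>auto simp: pair_del_vert_def\<close>)
      next
        fix h k assume hk: "h \<in> pverts H" "k \<in> pverts H" "h \<noteq> k"
        show "B h \<inter> B k = {}" using BB[OF hk] by blast
        have "touches (parcs (pair_del_vert v G)) (B h) (B k) \<longleftrightarrow> touches (parcs G) (B h) (B k)"
          using out(2) hk unfolding touches_def pair_del_vert_def by auto
        then show "touches (parcs (pair_del_vert v G)) (B h) (B k) \<longleftrightarrow> (h, k) \<in> parcs H"
          using BB[OF hk] by blast
      qed
    qed
  next
    case big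
    have "(x, y) \<in> (parcs G \<inter> B h \<times> B h)\<^sup>*" using B(3)[OF big(1)] big unfolding conn_def by blast
    then obtain v where v: "(x, v) \<in> parcs G" "v \<in> B h"
      using big(4) by (auto elim: converse_rtranclE)
    define r where "r = id(v := x)"
    have V': "pverts (pair_contract x v G) = r ` pverts G"
      and E': "parcs (pair_contract x v G) = map_prod r r ` parcs G - Id"
      unfolding r_def by (simp_all add: pair_contract_simps)
    have xv: "x \<noteq> v" "x \<in> pverts G" "v \<in> pverts G"
      using pair_graph_arc[OF less.prems(1) v(1)] by simp_all
    \<comment> \<open>Both ends of the contracted edge lie in \<open>B h\<close>, so every bag is a
      full preimage under \<open>r\<close>; this is why disjointness and adjacency survive the
      contraction.\<close>
    have sat: "p \<in> B k \<longleftrightarrow> r p \<in> r ` B k" if "k \<in> pverts H" for p k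
    proof (cases "k = h")
      case True
      then show ?thesis using v big xv by (auto simp: r_def)
    next
      case False
      then have "x \<notin> B k" "v \<notin> B k" using BB(1)[OF that big(1)] v big by auto
      then show ?thesis by (auto simp: r_def)
    qed
    have disj: "r ` B h \<inter> r ` B k = {}" if "h \<in> pverts H" "k \<in> pverts H" "h \<noteq> k" for h k
      using BB(1)[OF that] sat that by blast
    show ?thesis
    proof (rule step[OF induced_minor_step.contract[OF v(1)]])
      have "r ` pverts G = pverts G - {v}" using xv by (auto simp: r_def)
      then show "card (pverts (pair_contract x v G)) < card (pverts G)"
        unfolding V' using xv G.pair_finite_verts by (simp add: card_Diff1_less del: card_Diff_insert card_Diff_singleton)
      show "minor_model (pair_contract x v G) H (\<lambda>h. r ` B h)"
        unfolding minor_model_def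
      proof (intro conjI ballI impI)
        fix h assume h: "h \<in> pverts H"
        show "r ` B h \<noteq> {}" "r ` B h \<subseteq> pverts (pair_contract x v G)"
          using B[OF h] unfolding V' by auto
        show "conn (parcs (pair_contract x v G)) (r ` B h)"
          by (rule conn_map[OF B(3)[OF h]]) (auto simp: E')
      next
        fix h k assume hk: "h \<in> pverts H" "k \<in> pverts H" "h \<noteq> k"
        show "r ` B h \<inter> r ` B k = {}" using disj[OF hk] .
        have "touches (parcs (pair_contract x v G)) (r ` B h) (r ` B k) \<longleftrightarrow> touches (parcs G) (B h) (B k)"
        proof
          assume "touches (parcs (pair_contract x v G)) (r ` B h) (r ` B k)"
          then obtain p q where "(p, q) \<in> parcs G" "r p \<in> r ` B h" "r q \<in> r ` B k"
            unfolding touches_def E' by clarsimp (metis imageI)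
          then show "touches (parcs G) (B h) (B k)"
            unfolding touches_def using sat hk by blast
        next
          assume "touches (parcs G) (B h) (B k)"
          then obtain p q where pq: "(p, q) \<in> parcs G" "p \<in> B h" "q \<in> B k"
            unfolding touches_def by auto
          then have "r p \<noteq> r q" using disj[OF hk] by blast
          then show "touches (parcs (pair_contract x v G)) (r ` B h) (r ` B k)"
            unfolding touches_def E' using pq by (intro bexI[of _ "r p"] bexI[of _ "r q"]) auto
        qed
        then show "touches (parcs (pair_contract x v G)) (r ` B h) (r ` B k) \<longleftrightarrow> (h, k) \<in> parcs H"
          using BB[OF hk] by simp
      qed
    qed
  next
    case single
    obtain f where f: "f x \<in> pverts H \<and> x \<in> B (f x)" if "x \<in> pverts G" for x
      using single(1) by metis
    have fB: "f x = h" if "h \<in> pverts H" "x \<in> B h" for x h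
      using f[of x] B(2)[OF that(1)] BB(1)[of h "f x"] that by blast
    have "inj_on f (pverts G)"
      using f single(2) by (metis inj_onI)
    moreover have "pverts H = f ` pverts G"
      using f fB B by (auto simp: image_iff) (metis all_not_in_conv subsetD)
    moreover have "parcs H = map_prod f f ` parcs G"
    proof (intro set_eqI iffI)
      fix a assume a: "a \<in> parcs H"
      then obtain h k where hk: "a = (h, k)" "h \<in> pverts H" "k \<in> pverts H" "h \<noteq> k"
        using pair_graph_arc[OF assms(2)] by (cases a) auto
      then obtain x y where "x \<in> B h" "y \<in> B k" "(x, y) \<in> parcs G"
        using BB(2)[of h k] a unfolding touches_def by auto
      then show "a \<in> map_prod f f ` parcs G" using hk fB by (auto intro!: image_eqI[of _ _ "(x, y)"])
    next
      fix a assume "a \<in> map_prod f f ` parcs G"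
      then obtain x y where xy: "(x, y) \<in> parcs G" "a = (f x, f y)" by auto
      then have V: "x \<in> pverts G" "y \<in> pverts G" "x \<noteq> y"
        using pair_graph_arc[OF less.prems(1)] by auto
      then have "f x \<noteq> f y" using f single(2) by metis
      then show "a \<in> parcs H"
        using BB(2)[of "f x" "f y"] f V xy unfolding touches_def by blast
    qed
    ultimately show ?thesis
      unfolding contains_induced_minor_def using digraph_iso_with_proj[OF less.prems(1)] by blast
  qed
qed

theorem contains_induced_minor_iff_model:
  assumes "pair_graph G" "pair_graph H"
  shows "contains_induced_minor G H \<longleftrightarrow> (\<exists>B. minor_model G H B)"
  using assms minor_model_if_contains contains_if_minor_model by blast

section \<open>Two disjoint linking subgraphs\<close>

definition component :: "('a \<times> 'a) set \<Rightarrow> 'a set \<Rightarrow> 'a \<Rightarrow> 'a set" where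
  "component E S x = {y. (x, y) \<in> (E \<inter> S \<times> S)\<^sup>*}"

lemma component_self: "x \<in> component E S x"
  by (simp add: component_def)

lemma component_subset: "x \<in> S \<Longrightarrow> component E S x \<subseteq> S"
  unfolding component_def by (auto elim: rtranclE)

lemma component_closed:
  "x \<in> S \<Longrightarrow> y \<in> component E S x \<Longrightarrow> (y, z) \<in> E \<Longrightarrow> z \<in> S \<Longrightarrow> z \<in> component E S x"
  using component_subset[of x S E] unfolding component_def by (auto intro: rtrancl_into_rtrancl)

lemma component_mono: "S \<subseteq> T \<Longrightarrow> component E S x \<subseteq> component E T x"
  unfolding component_def using rtrancl_mono[of "E \<inter> S \<times> S" "E \<inter> T \<times> T"] by blast

lemma conn_subset_component: "conn E S \<Longrightarrow> S \<subseteq> T \<Longrightarrow> x \<in> S \<Longrightarrow> S \<subseteq> component E T x"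
proof
  fix y assume "conn E S" "S \<subseteq> T" "x \<in> S" "y \<in> S"
  then have "(x, y) \<in> (E \<inter> S \<times> S)\<^sup>*" unfolding conn_def by blast
  then have "y \<in> component E S x" unfolding component_def by simp
  then show "y \<in> component E T x" using component_mono[OF \<open>S \<subseteq> T\<close>] by (rule rev_subsetD)
qed

lemma sym_rtrancl_induced:
  assumes "sym E" "(x, y) \<in> (E \<inter> S \<times> S)\<^sup>*"
  shows "(y, x) \<in> (E \<inter> S \<times> S)\<^sup>*"
proof -
  have "sym (E \<inter> S \<times> S)"
    by (rule symI) (use symD[OF assms(1)] in blast)
  from symD[OF sym_rtrancl[OF this] assms(2)] show ?thesis .
qed

lemma conn_component:
  assumes "sym E" "x \<in> S"
  shows "conn E (component E S x)"
proof -
  let ?K = "component E S x"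
  have "(x, y) \<in> (E \<inter> ?K \<times> ?K)\<^sup>*" if "(x, y) \<in> (E \<inter> S \<times> S)\<^sup>*" for y
    using that
  proof induction
    case (step y z)
    then have "y \<in> ?K" "z \<in> ?K"
      unfolding component_def by (auto intro: rtrancl_into_rtrancl)
    with step show ?case by (auto intro: rtrancl_into_rtrancl)
  qed simp
  then have "(x, y) \<in> (E \<inter> ?K \<times> ?K)\<^sup>*" if "y \<in> ?K" for y
    using that unfolding component_def by blast
  then show ?thesis
    unfolding conn_def using sym_rtrancl_induced[OF assms(1)] by (meson rtrancl_trans)
qed

lemma conn_singleton: "conn E {x}"
  by (simp add: conn_def)

lemma touches_sym: "sym E \<Longrightarrow> touches E S T \<Longrightarrow> touches E T S"
  unfolding touches_def by (auto dest: symD)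

lemma conn_Un:
  assumes "sym E" "conn E S" "conn E T" "touches E S T"
  shows "conn E (S \<union> T)"
proof -
  let ?R = "(E \<inter> (S \<union> T) \<times> (S \<union> T))\<^sup>*"
  obtain s t where st: "s \<in> S" "t \<in> T" "(s, t) \<in> E"
    using assms(4) unfolding touches_def by blast
  have S: "(x, y) \<in> ?R" if "x \<in> S" "y \<in> S" for x y
    using assms(2) that rtrancl_mono[of "E \<inter> S \<times> S" "E \<inter> (S \<union> T) \<times> (S \<union> T)"] unfolding conn_def by blast
  have T: "(x, y) \<in> ?R" if "x \<in> T" "y \<in> T" for x y
    using assms(3) that rtrancl_mono[of "E \<inter> T \<times> T" "E \<inter> (S \<union> T) \<times> (S \<union> T)"] unfolding conn_def by blast
  have "(s, x) \<in> ?R" if "x \<in> S \<union> T" for x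
  proof (cases "x \<in> S")
    case True
    then show ?thesis using S st by blast
  next
    case False
    have "(s, t) \<in> ?R" using st by (intro r_into_rtrancl) blast
    with False that T st show ?thesis by (meson UnE rtrancl_trans)
  qed
  then show ?thesis
    unfolding conn_def using sym_rtrancl_induced[OF assms(1)] by (meson rtrancl_trans)
qed

lemma conn_insert:
  assumes "sym E" "conn E S" "s \<in> S" "(x, s) \<in> E"
  shows "conn E (insert x S)"
  using conn_Un[OF assms(1) conn_singleton assms(2), of x] assms(3,4) by (auto simp: touches_def)

lemma conn_crossing:
  assumes "conn E S" "x \<in> S" "x \<in> T" "y \<in> S" "y \<notin> T"
  obtains p q where "p \<in> S" "p \<in> T" "q \<in> S" "q \<notin> T" "(p, q) \<in> E"
proof -
  have "\<exists>p q. p \<in> S \<and> p \<in> T \<and> q \<in> S \<and> q \<notin> T \<and> (p, q) \<in> E" if "(x, y) \<in> (E \<inter> S \<times> S)\<^sup>*"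
    using that assms(5)
  proof induction
    case (step y z)
    then show ?case by (cases "y \<in> T") auto
  qed (use assms(3) in auto)
  then show ?thesis using that assms unfolding conn_def by blast
qed

text \<open>A largest connected proper subset containing \<open>r\<close> misses just one vertex,
  for it can always be extended by a neighbour. The root \<open>r\<close> makes it possible to
  obtain a second non-cut vertex different from a first one.\<close>

lemma conn_noncut:
  assumes "sym E" "conn E S" "finite S" "r \<in> S" "S \<noteq> {r}"
  obtains x where "x \<in> S" "x \<noteq> r" "conn E (S - {x})"
proof -
  let ?P = "\<lambda>T. r \<in> T \<and> T \<subset> S \<and> conn E T"
  have "?P {r}" using assms(4,5) by (auto simp: conn_singleton)
  moreover have "\<forall>T. ?P T \<longrightarrow> card T < card S"
    using psubset_card_mono[OF assms(3)] by simp
  ultimately obtain T where T: "?P T" "\<And>U. ?P U \<Longrightarrow> card U \<le> card T"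
    using ex_has_greatest_nat[of ?P "{r}" card "card S"] by blast
  then obtain y where "y \<in> S" "y \<notin> T" by blast
  with T obtain p q where pq: "p \<in> S" "p \<in> T" "q \<in> S" "q \<notin> T" "(p, q) \<in> E"
    using conn_crossing[OF assms(2), of r T y] by blast
  have "conn E (insert q T)"
    by (rule conn_insert[OF assms(1) _ pq(2)]) (use T pq assms(1) in \<open>auto dest: symD\<close>)
  moreover have "card (insert q T) > card T"
    using pq T finite_subset[OF _ assms(3), of T] by (simp add: psubset_imp_subset)
  ultimately have "\<not> insert q T \<subset> S" using T by (meson insertCI leD)
  then have "insert q T = S" using T pq by blast
  then have "S - {q} = T" using pq by blast
  then show ?thesis using that[of q] T pq by auto
qed

text \<open>
  Menger's theorem for two paths, with connected sets in place of paths. The induction removes a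
  vertex \<open>x\<close> of \<open>X\<close> and adds its neighbours to \<open>X\<close>.
\<close>

lemma two_linked:
  assumes "sym E" "finite K" "K \<noteq> {}"
    and "\<forall>v\<in>K. \<exists>P\<subseteq>K - {v}. conn E P \<and> P \<inter> X \<noteq> {} \<and> P \<inter> Y \<noteq> {}"
  shows "\<exists>C D. C \<subseteq> K \<and> D \<subseteq> K \<and> C \<inter> D = {} \<and> conn E C \<and> conn E D \<and>
    C \<inter> X \<noteq> {} \<and> C \<inter> Y \<noteq> {} \<and> D \<inter> X \<noteq> {} \<and> D \<inter> Y \<noteq> {}"
  using assms(2-4)
proof (induction "card K" arbitrary: K X rule: less_induct)
  case less
  show ?case
  proof (cases "K \<inter> X \<inter> Y = {}")
    case False
    \<comment> \<open>A common vertex of \<open>X\<close> and \<open>Y\<close> is one of the two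
      sets by itself; the hypothesis for this vertex supplies the other.\<close>
    then obtain z where z: "z \<in> K" "z \<in> X" "z \<in> Y" by blast
    then obtain P where "P \<subseteq> K - {z}" "conn E P" "P \<inter> X \<noteq> {}" "P \<inter> Y \<noteq> {}"
      using less.prems(3) by blast
    then show ?thesis
      using z by (intro exI[of _ "{z}"] exI[of _ P]) (auto simp: conn_singleton)
  next
    case XY: True
    obtain x y where x: "x \<in> K" "x \<in> X" "y \<in> K" "y \<in> Y" "y \<noteq> x"
      using less.prems(2,3) XY by blast
    let ?K = "K - {x}" and ?X = "X \<union> E `` {x}"
    \<comment> \<open>The hypothesis survives the removal of \<open>x\<close>: if \<open>P\<close>
      contains \<open>x\<close>, the component of \<open>P - {x}\<close> around a vertex of
      \<open>Y\<close> has a neighbour of \<open>x\<close>, hence meets the enlarged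
      \<open>X\<close>.\<close>
    have hyp: "\<forall>v\<in>?K. \<exists>P\<subseteq>?K - {v}. conn E P \<and> P \<inter> ?X \<noteq> {} \<and> P \<inter> Y \<noteq> {}"
    proof
      fix v assume v: "v \<in> ?K"
      obtain P where P: "P \<subseteq> K - {v}" "conn E P" "P \<inter> X \<noteq> {}" "P \<inter> Y \<noteq> {}"
        using bspec[OF less.prems(3), of v] v by auto
      show "\<exists>P\<subseteq>?K - {v}. conn E P \<and> P \<inter> ?X \<noteq> {} \<and> P \<inter> Y \<noteq> {}"
      proof (cases "x \<in> P")
        case False
        with P show ?thesis by (intro exI[of _ P]) auto
      next
        case True
        obtain t where t: "t \<in> P" "t \<in> Y" using P by blast
        have tx: "t \<in> P - {x}" using t x XY P by blast
        let ?Q = "component E (P - {x}) t"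
        have Q: "?Q \<subseteq> P - {x}" "t \<in> ?Q" "conn E ?Q"
          using component_subset[OF tx] component_self conn_component[OF assms(1) tx] by auto
        obtain p q where pq: "p \<in> P" "p \<in> ?Q" "q \<in> P" "q \<notin> ?Q" "(p, q) \<in> E"
          using conn_crossing[OF P(2) t(1) Q(2) True] Q(1) by blast
        have "q = x" using component_closed[OF tx pq(2,5)] pq by blast
        then have "p \<in> ?X" using pq(5) symD[OF assms(1)] by blast
        then show ?thesis using P Q pq t by (intro exI[of _ ?Q]) blast
      qed
    qed
    have "card ?K < card K" "finite ?K" "?K \<noteq> {}"
      using x card_Diff1_less[OF less.prems(1) x(1)] less.prems(1) by blast+
    from less.hyps[OF this hyp] obtain C D where CD: "C \<subseteq> ?K" "D \<subseteq> ?K" "C \<inter> D = {}" "conn E C" "conn E D"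
      "C \<inter> ?X \<noteq> {}" "C \<inter> Y \<noteq> {}" "D \<inter> ?X \<noteq> {}" "D \<inter> Y \<noteq> {}"
      by (elim exE conjE)
    have ins: "conn E (insert x S)" if "S \<inter> X = {}" "S \<inter> ?X \<noteq> {}" "conn E S" for S
    proof -
      obtain s where "s \<in> S" "(x, s) \<in> E" using \<open>S \<inter> X = {}\<close> \<open>S \<inter> ?X \<noteq> {}\<close> by blast
      then show ?thesis using conn_insert[OF assms(1) \<open>conn E S\<close>] by blast
    qed
    \<comment> \<open>If one of the two sets meets the original \<open>X\<close>, then
      \<open>x\<close> is free to be added to the other.\<close>
    have one: ?thesis if "C \<subseteq> ?K" "D \<subseteq> ?K" "C \<inter> D = {}" "conn E C" "conn E D"
      "C \<inter> ?X \<noteq> {}" "C \<inter> Y \<noteq> {}" "D \<inter> X \<noteq> {}" "D \<inter> Y \<noteq> {}" for C D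
    proof (cases "C \<inter> X = {}")
      case True
      show ?thesis
        by (intro exI[of _ "insert x C"] exI[of _ D]) (use ins[OF True] that x in auto)
    next
      case False
      show ?thesis
        by (intro exI[of _ C] exI[of _ D]) (use False that in auto)
    qed
    consider (D) "D \<inter> X \<noteq> {}" | (C) "C \<inter> X \<noteq> {}" | (none) "C \<inter> X = {}" "D \<inter> X = {}" by blast
    then show ?thesis
    proof cases
      case D
      then show ?thesis using one[OF CD(1-7) D CD(9)] by simp
    next
      case C
      then show ?thesis using one[OF CD(2,1) _ CD(5,4,8,9) C CD(7)] CD(3) by (simp add: Int_commute)
    next
      case none
      \<comment> \<open>Now both sets would need \<open>x\<close>. A set \<open>P\<close> linking
        \<open>X\<close> to \<open>Y\<close> without \<open>x\<close> helps: if it is disjoint from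
        both, it replaces \<open>D\<close>; otherwise its part around a vertex of \<open>X\<close>
        is merged with whichever of \<open>C\<close>, \<open>D\<close> it borders on, and
        \<open>x\<close> is left to the other.\<close>
      obtain P where P: "P \<subseteq> K - {x}" "conn E P" "P \<inter> X \<noteq> {}" "P \<inter> Y \<noteq> {}"
        using bspec[OF less.prems(3) x(1)] by blast
      obtain s where s: "s \<in> P" "s \<in> X" using P by blast
      show ?thesis
      proof (cases "P \<inter> (C \<union> D) = {}")
        case True
        then show ?thesis using one[OF CD(1) P(1) _ CD(4) P(2) CD(6,7) P(3,4)] by blast
      next
        case False
        have sP: "s \<in> P - (C \<union> D)" using s none by blast
        let ?S = "component E (P - (C \<union> D)) s"
        have S: "?S \<subseteq> P - (C \<union> D)" "s \<in> ?S" "conn E ?S"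
          using component_subset[OF sP] component_self conn_component[OF assms(1) sP] by auto
        obtain u where u: "u \<in> P" "u \<in> C \<union> D" using False by blast
        obtain p q where pq: "p \<in> P" "p \<in> ?S" "q \<in> P" "q \<notin> ?S" "(p, q) \<in> E"
          using conn_crossing[OF P(2) s(1) S(2) u(1)] u S(1) by blast
        have "q \<in> C \<union> D" using component_closed[OF sP pq(2,5)] pq by blast
        then show ?thesis
        proof
          assume q: "q \<in> C"
          have cn: "conn E (?S \<union> C)"
            using conn_Un[OF assms(1) S(3) CD(4)] pq q unfolding touches_def by blast
          have "?S \<union> C \<subseteq> ?K" "D \<inter> (?S \<union> C) = {}" "(?S \<union> C) \<inter> X \<noteq> {}" "(?S \<union> C) \<inter> Y \<noteq> {}"
            using CD(1,3,7) P(1) S(1,2) s(2) by blast+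
          then show ?thesis by (rule one[OF CD(2) _ _ CD(5) cn CD(8,9)])
        next
          assume q: "q \<in> D"
          have cn: "conn E (?S \<union> D)"
            using conn_Un[OF assms(1) S(3) CD(5)] pq q unfolding touches_def by blast
          have "?S \<union> D \<subseteq> ?K" "C \<inter> (?S \<union> D) = {}" "(?S \<union> D) \<inter> X \<noteq> {}" "(?S \<union> D) \<inter> Y \<noteq> {}"
            using CD(2,3,9) P(1) S(1,2) s(2) by blast+
          then show ?thesis by (rule one[OF CD(1) _ _ CD(4) cn CD(6,7)])
        qed
      qed
    qed
  qed
qed

text \<open>
  In some component of \<open>W\<close> no single vertex \<open>v\<close> separates \<open>X\<close> from \<open>Y\<close>; the component is given by
  one of its vertices \<open>k\<close>.
\<close>

definition doubly_linked :: "('a \<times> 'a) set \<Rightarrow> 'a set \<Rightarrow> 'a set \<Rightarrow> 'a set \<Rightarrow> bool" where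
  "doubly_linked E W X Y \<longleftrightarrow> (\<exists>k\<in>W. \<forall>v\<in>W. (k, v) \<in> (E \<inter> W \<times> W)\<^sup>* \<longrightarrow>
      (\<exists>s\<in>W - {v}. \<exists>t\<in>W - {v}. s \<in> X \<and> t \<in> Y \<and> (k, s) \<in> (E \<inter> W \<times> W)\<^sup>* \<and>
         (s, t) \<in> (E \<inter> (W - {v}) \<times> (W - {v}))\<^sup>*))"

text \<open>From left to right, a vertex \<open>v\<close> lies in at most one of \<open>C\<close>
  and \<open>D\<close>, so the other still links \<open>X\<close> to \<open>Y\<close> without it.
  From right to left, the two sets provided by Menger's theorem share a component, which allows one
  of them to grow until they touch.\<close>

lemma two_linked_touching_iff:
  assumes "sym E" "finite W"
  shows "(\<exists>C D. C \<subseteq> W \<and> D \<subseteq> W \<and> C \<inter> D = {} \<and> conn E C \<and> conn E D \<and> touches E C D \<and>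
      C \<inter> X \<noteq> {} \<and> C \<inter> Y \<noteq> {} \<and> D \<inter> X \<noteq> {} \<and> D \<inter> Y \<noteq> {}) \<longleftrightarrow>
    doubly_linked E W X Y" (is "?L \<longleftrightarrow> ?R")
proof
  assume ?L
  then obtain C D where CD: "C \<subseteq> W" "D \<subseteq> W" "C \<inter> D = {}" "conn E C" "conn E D" "touches E C D"
     "C \<inter> X \<noteq> {}" "C \<inter> Y \<noteq> {}" "D \<inter> X \<noteq> {}" "D \<inter> Y \<noteq> {}" by blast
  obtain k where k: "k \<in> C" using CD by blast
  have CDconn: "conn E (C \<union> D)" using conn_Un[OF assms(1)] CD by blast
  have 1: "(k, s) \<in> (E \<inter> W \<times> W)\<^sup>*" if "s \<in> C \<union> D" for s
    using conn_subset_component[OF CDconn, of W k] that k CD unfolding component_def by blast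
  have 2: "\<exists>s\<in>W - {v}. \<exists>t\<in>W - {v}. s \<in> X \<and> t \<in> Y \<and> (k, s) \<in> (E \<inter> W \<times> W)\<^sup>* \<and>
         (s, t) \<in> (E \<inter> (W - {v}) \<times> (W - {v}))\<^sup>*"
    if "S \<subseteq> C \<union> D" "v \<notin> S" "conn E S" "S \<inter> X \<noteq> {}" "S \<inter> Y \<noteq> {}" for v S
  proof -
    obtain s t where st: "s \<in> S" "s \<in> X" "t \<in> S" "t \<in> Y" using \<open>S \<inter> X \<noteq> {}\<close> \<open>S \<inter> Y \<noteq> {}\<close> by blast
    have "S \<subseteq> W - {v}" using that CD by blast
    then show ?thesis
      using st 1[of s] conn_subset_component[OF that(3), of "W - {v}" s] that(1) unfolding component_def by blast
  qed
  show ?R unfolding doubly_linked_def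
  proof (rule bexI[of _ k], intro ballI impI)
    fix v assume "v \<in> W" "(k, v) \<in> (E \<inter> W \<times> W)\<^sup>*"
    show "\<exists>s\<in>W - {v}. \<exists>t\<in>W - {v}. s \<in> X \<and> t \<in> Y \<and> (k, s) \<in> (E \<inter> W \<times> W)\<^sup>* \<and>
         (s, t) \<in> (E \<inter> (W - {v}) \<times> (W - {v}))\<^sup>*"
      using 2[of C v] 2[of D v] CD by blast
  qed (use k CD in auto)
next
  assume ?R
  then obtain k where k: "k \<in> W" and R: "\<And>v. v \<in> W \<Longrightarrow> (k, v) \<in> (E \<inter> W \<times> W)\<^sup>* \<Longrightarrow>
      (\<exists>s\<in>W - {v}. \<exists>t\<in>W - {v}. s \<in> X \<and> t \<in> Y \<and> (k, s) \<in> (E \<inter> W \<times> W)\<^sup>* \<and>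
         (s, t) \<in> (E \<inter> (W - {v}) \<times> (W - {v}))\<^sup>*)" unfolding doubly_linked_def by blast
  let ?K = "component E W k"
  have K: "?K \<subseteq> W" "k \<in> ?K" "conn E ?K"
    using component_subset[OF k] component_self conn_component[OF assms(1) k] by auto
  have hyp: "\<forall>v\<in>?K. \<exists>P\<subseteq>?K - {v}. conn E P \<and> P \<inter> X \<noteq> {} \<and> P \<inter> Y \<noteq> {}"
  proof
    fix v assume v: "v \<in> ?K"
    have "v \<in> W" "(k, v) \<in> (E \<inter> W \<times> W)\<^sup>*" using v K unfolding component_def by auto
    then obtain s t where st: "s \<in> W - {v}" "s \<in> X" "t \<in> Y" "(k, s) \<in> (E \<inter> W \<times> W)\<^sup>*"
         "(s, t) \<in> (E \<inter> (W - {v}) \<times> (W - {v}))\<^sup>*" using R[of v] by blast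
    let ?P = "component E (W - {v}) s"
    have P: "?P \<subseteq> W - {v}" "conn E ?P" "s \<in> ?P" "t \<in> ?P"
      using component_subset[OF st(1)] conn_component[OF assms(1) st(1)] st(5)
      by (auto simp: component_def)
    have "?P \<subseteq> ?K"
      using component_mono[of "W - {v}" W E s] st(4) unfolding component_def by (auto intro: rtrancl_trans)
    then show "\<exists>P\<subseteq>?K - {v}. conn E P \<and> P \<inter> X \<noteq> {} \<and> P \<inter> Y \<noteq> {}"
      using P st by (intro exI[of _ ?P]) blast
  qed
  have "finite ?K" "?K \<noteq> {}" using finite_subset[OF K(1) assms(2)] K(2) by blast+
  from two_linked[OF assms(1) this hyp] obtain C D where CD: "C \<subseteq> ?K" "D \<subseteq> ?K" "C \<inter> D = {}" "conn E C" "conn E D"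
     "C \<inter> X \<noteq> {}" "C \<inter> Y \<noteq> {}" "D \<inter> X \<noteq> {}" "D \<inter> Y \<noteq> {}"
    by (elim exE conjE)
  obtain c d where c: "c \<in> C" "d \<in> D" using CD by blast
  have cK: "c \<in> ?K - D" using c CD by blast
  \<comment> \<open>\<open>C\<close> is replaced by its component in \<open>?K - D\<close>. As
    \<open>?K\<close> is connected, some edge leaves this component, and it can only lead to
    \<open>D\<close>.\<close>
  let ?C = "component E (?K - D) c"
  have C: "?C \<subseteq> ?K - D" "conn E ?C" "c \<in> ?C"
    using component_subset[OF cK] conn_component[OF assms(1) cK] component_self by auto
  have CC: "C \<subseteq> ?C"
    by (rule conn_subset_component[OF CD(4) _ c(1)]) (use CD in blast)
  obtain p q where pq: "p \<in> ?K" "p \<in> ?C" "q \<in> ?K" "q \<notin> ?C" "(p, q) \<in> E"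
    using conn_crossing[OF K(3), of c ?C d] c C CD by blast
  have "q \<in> D" using component_closed[OF cK pq(2,5)] pq by blast
  then have "touches E ?C D" using pq unfolding touches_def by blast
  moreover have "?C \<subseteq> W" "D \<subseteq> W" "?C \<inter> D = {}" "?C \<inter> X \<noteq> {}" "?C \<inter> Y \<noteq> {}"
    using C(1) CC CD(2,6,7) K(1) by blast+
  ultimately show ?L using C(2) CD(5,8,9) by (intro exI[of _ ?C] exI[of _ D] conjI)
qed

section \<open>Bags of the kite\<close>

text \<open>The bags of the vertices \<open>1, \<dots>, 5\<close> of the kite are \<open>{a}\<close>, \<open>B\<close>, \<open>C\<close>, \<open>D\<close>, \<open>{e}\<close>.\<close>

definition kite_bags :: "('a \<times> 'a) set \<Rightarrow> 'a set \<Rightarrow> 'a \<Rightarrow> 'a set \<Rightarrow> 'a set \<Rightarrow> 'a set \<Rightarrow> 'a \<Rightarrow> bool" where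
  "kite_bags E V a B C D e \<longleftrightarrow>
     a \<in> V \<and> e \<in> V \<and> B \<subseteq> V \<and> C \<subseteq> V \<and> D \<subseteq> V \<and> a \<noteq> e \<and>
     B \<inter> C = {} \<and> B \<inter> D = {} \<and> C \<inter> D = {} \<and>
     a \<notin> B \<and> a \<notin> C \<and> a \<notin> D \<and> e \<notin> B \<and> e \<notin> C \<and> e \<notin> D \<and>
     conn E B \<and> conn E C \<and> conn E D \<and>
     touches E B C \<and> touches E B D \<and> touches E C D \<and>
     touches E {a} B \<and> touches E {e} C \<and> touches E {e} D \<and>
     \<not> touches E {a} C \<and> \<not> touches E {a} D \<and> \<not> touches E {e} B \<and> (a, e) \<notin> E"

lemma
  assumes "kite_bags E V a B C D e"
  shows kite_bags_sets: "a \<in> V" "e \<in> V" "B \<subseteq> V" "C \<subseteq> V" "D \<subseteq> V" "a \<noteq> e"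
      "B \<inter> C = {}" "B \<inter> D = {}" "C \<inter> D = {}" "a \<notin> B" "a \<notin> C" "a \<notin> D" "e \<notin> B" "e \<notin> C" "e \<notin> D"
    and kite_bags_conn: "conn E B" "conn E C" "conn E D"
    and kite_bags_touches: "touches E B C" "touches E B D" "touches E C D"
      "touches E {a} B" "touches E {e} C" "touches E {e} D"
    and kite_bags_not_touches: "\<not> touches E {a} C" "\<not> touches E {a} D" "\<not> touches E {e} B" "\<not> touches E {a} {e}"
    and kite_bags_nonadj: "\<And>x. x \<in> C \<Longrightarrow> (a, x) \<notin> E" "\<And>x. x \<in> D \<Longrightarrow> (a, x) \<notin> E" "\<And>x. x \<in> B \<Longrightarrow> (e, x) \<notin> E" "(a, e) \<notin> E"
  using assms by (simp_all add: kite_bags_def) (simp_all add: touches_def)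

section \<open>Bag systems of the kite and minor models\<close>

lemma kite_simps:
  "pverts kite = {1, 2, 3, 4, 5}"
  "(h, k) \<in> parcs kite \<longleftrightarrow> (h, k) \<in> {(1, 2), (2, 3), (2, 4), (3, 4), (3, 5), (4, 5),
     (2, 1), (3, 2), (4, 2), (4, 3), (5, 3), (5, 4)}"
  by (auto simp: kite_def Let_def)

lemma touches_mono: "touches E S T \<Longrightarrow> S \<subseteq> S' \<Longrightarrow> T \<subseteq> T' \<Longrightarrow> touches E S' T'"
  unfolding touches_def by blast

lemma touches_remove: "touches E B S \<Longrightarrow> \<not> touches E (B - {z}) S \<Longrightarrow> touches E {z} S"
  unfolding touches_def by blast

lemma touches_Un: "touches E S (T \<union> T') \<longleftrightarrow> touches E S T \<or> touches E S T'"
  unfolding touches_def by blast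

lemma minor_model_kite_if_bags:
  assumes "sym (parcs G)" "kite_bags (parcs G) (pverts G) a B C D e"
  shows "\<exists>M. minor_model G kite M"
proof -
  let ?t = "touches (parcs G)"
  have swap: "?t S T \<longleftrightarrow> ?t T S" for S T
    using touches_sym[OF assms(1)] by blast
  define M where "M h = (if h = 1 then {a} else if h = 2 then B else if h = 3 then C else if h = 4 then D else {e})" for h :: nat
  have M: "M (Suc 0) = {a}" "M 2 = B" "M 3 = C" "M 4 = D" "M 5 = {e}"
    by (simp_all add: M_def)
  note K = assms(2)
  note facts = kite_bags_sets[OF K] kite_bags_conn[OF K] kite_bags_touches[OF K] kite_bags_not_touches[OF K]
  have ne: "B \<noteq> {}" "C \<noteq> {}" "D \<noteq> {}"
    using kite_bags_touches[OF K] unfolding touches_def by blast+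
  have 1: "M h \<noteq> {} \<and> M h \<subseteq> pverts G \<and> conn (parcs G) (M h)" if "h \<in> pverts kite" for h
    using that unfolding kite_simps(1)
    by (elim insertE emptyE) (simp_all add: M conn_singleton facts ne)
  \<comment> \<open>Ten pairs are checked; the reversed ones follow by symmetry.\<close>
  have 2: "M h \<inter> M k = {} \<and> (?t (M h) (M k) \<longleftrightarrow> (h, k) \<in> parcs kite)"
    if "h \<in> pverts kite" "k \<in> pverts kite" "h < k" for h k
    using that unfolding kite_simps
    by (elim insertE emptyE)
      (simp_all add: M facts swap[of C "{e}"] swap[of D "{e}"] swap[of B "{e}"])
  have 3: "(h, k) \<in> parcs kite \<longleftrightarrow> (k, h) \<in> parcs kite" for h k
    unfolding kite_simps(2) by auto
  have "M h \<inter> M k = {} \<and> (?t (M h) (M k) \<longleftrightarrow> (h, k) \<in> parcs kite)"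
    if "h \<in> pverts kite" "k \<in> pverts kite" "h \<noteq> k" for h k
  proof (cases "h < k")
    case True
    then show ?thesis using 2[OF that(1,2)] by simp
  next
    case False
    then have "k < h" using that(3) by simp
    from 2[OF that(2,1) this] show ?thesis
      unfolding 3[of h k] swap[of "M h" "M k"] by (simp add: Int_commute)
  qed
  with 1 have "minor_model G kite M"
    unfolding minor_model_def by blast
  then show ?thesis by blast
qed

text \<open>For \<open>a\<close> any vertex of its bag adjacent to \<open>B\<close> will do. For
  \<open>e\<close> a vertex of its bag \<open>F\<close> adjacent to \<open>D\<close> is chosen; if
  it misses \<open>C\<close>, a connected part of \<open>F\<close> between \<open>C\<close> and
  \<open>e\<close> is added to \<open>C\<close>. The bag \<open>A\<close> does not touch
  \<open>F\<close>, so \<open>a\<close> stays away from the larger \<open>C\<close>.\<close>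

lemma kite_bags_if_minor_model:
  assumes sym: "sym (parcs G)" and M: "minor_model G kite M"
  shows "\<exists>a B C D e. kite_bags (parcs G) (pverts G) a B C D e"
proof -
  let ?t = "touches (parcs G)" and ?E = "parcs G"
  have 1: "M h \<subseteq> pverts G" "conn ?E (M h)" if "h \<in> {1, 2, 3, 4, 5}" for h
    using M that unfolding minor_model_def kite_simps(1) by blast+
  have 2: "M h \<inter> M k = {}" "?t (M h) (M k) \<longleftrightarrow> (h, k) \<in> parcs kite"
    if "h \<in> {1, 2, 3, 4, 5}" "k \<in> {1, 2, 3, 4, 5}" "h \<noteq> k" for h k
    using M that unfolding minor_model_def kite_simps(1) by blast+
  define A B C D F where "A = M 1" and "B = M 2" and "C = M 3" and "D = M 4" and "F = M 5"
  have V: "A \<subseteq> pverts G" "B \<subseteq> pverts G" "C \<subseteq> pverts G" "D \<subseteq> pverts G" "F \<subseteq> pverts G"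
    and cn: "conn ?E B" "conn ?E C" "conn ?E D" "conn ?E F"
    unfolding A_def B_def C_def D_def F_def by (simp_all add: 1)
  have dj: "A \<inter> B = {}" "A \<inter> C = {}" "A \<inter> D = {}" "A \<inter> F = {}" "B \<inter> C = {}" "B \<inter> D = {}" "B \<inter> F = {}"
    "C \<inter> D = {}" "C \<inter> F = {}" "D \<inter> F = {}"
    unfolding A_def B_def C_def D_def F_def by (simp_all add: 2(1))
  have t: "?t A B" "?t B C" "?t B D" "?t C D" "?t F C" "?t F D"
    and nt: "\<not> ?t A C" "\<not> ?t A D" "\<not> ?t A F" "\<not> ?t F B"
    unfolding A_def B_def C_def D_def F_def by (simp_all add: 2(2) kite_simps(2))
  obtain a where a: "a \<in> A" "?t {a} B" using t(1) unfolding touches_def by blast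
  obtain e where e: "e \<in> F" "?t {e} D" using t(6) unfolding touches_def by blast
  have ntm: "\<not> ?t S' T'" if "\<not> ?t S T" "S' \<subseteq> S" "T' \<subseteq> T" for S T S' T'
    using that touches_mono by metis
  have nae: "(a, e) \<notin> ?E" using nt(3) a(1) e(1) unfolding touches_def by blast
  have rest: "kite_bags ?E (pverts G) a B C' D e"
    if C': "C \<subseteq> C'" "C' \<subseteq> C \<union> (F - {e})" "conn ?E C'" "?t {e} C'" for C'
  proof -
    have "\<not> ?t A (C \<union> F)" using nt unfolding touches_Un by blast
    then have "\<not> ?t {a} C'" by (rule ntm) (use a C' in auto)
    moreover have "\<not> ?t {a} D" by (rule ntm[OF nt(2)]) (use a in auto)
    moreover have "\<not> ?t {e} B" by (rule ntm[OF nt(4)]) (use e in auto)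
    moreover have "?t B C'" "?t C' D"
      using touches_mono[OF t(2), of B C'] touches_mono[OF t(4), of C' D] C' by auto
    moreover have "a \<in> pverts G" "e \<in> pverts G" "a \<noteq> e" "a \<notin> B" "a \<notin> D" "e \<notin> B" "e \<notin> D"
      using a(1) e(1) V(1,5) dj(1,3,4,7,10) by auto
    moreover have "C' \<subseteq> pverts G" "B \<inter> C' = {}" "C' \<inter> D = {}" using C'(2) V(3,5) dj(5,7,8,10) by blast+
    moreover have "a \<notin> C'" "e \<notin> C'" using C'(2) a(1) e(1) dj(2,4,9) by blast+
    ultimately show ?thesis
      unfolding kite_bags_def using a(2) e(2) cn(1,3) C'(3,4) nae V(2,4) dj(6) t(3) by simp
  qed
  show ?thesis
  proof (cases "?t {e} C")
    case True
    then show ?thesis using rest[of C] cn(2) by blast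
  next
    case False
    obtain f c where f: "f \<in> F" "c \<in> C" "(f, c) \<in> ?E" using t(5) unfolding touches_def by blast
    have fF: "f \<in> F - {e}" using False f unfolding touches_def by blast
    let ?K = "component ?E (F - {e}) f"
    have K: "?K \<subseteq> F - {e}" "f \<in> ?K" "conn ?E ?K"
      using component_subset[OF fF] component_self conn_component[OF sym fF] by auto
    obtain p q where pq: "p \<in> F" "p \<in> ?K" "q \<in> F" "q \<notin> ?K" "(p, q) \<in> ?E"
      using conn_crossing[OF cn(4) f(1) K(2) e(1)] K(1) by blast
    \<comment> \<open>An edge leaving the component \<open>?K\<close> inside \<open>F\<close> can
      only end in the removed vertex \<open>e\<close>.\<close>
    have "q = e" using component_closed[OF fF pq(2,5)] pq by blast
    then have "(e, p) \<in> ?E" using pq(5) sym by (blast dest: symD)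
    then have "?t {e} (C \<union> ?K)" using pq(2) unfolding touches_def by blast
    moreover have "conn ?E (C \<union> ?K)"
    proof (rule conn_Un[OF sym cn(2) K(3)])
      have "(c, f) \<in> ?E" using f(3) sym by (blast dest: symD)
      then show "?t C ?K" using f(2) K(2) unfolding touches_def by blast
    qed
    moreover have "C \<union> ?K \<subseteq> C \<union> (F - {e})" using K(1) by blast
    ultimately show ?thesis using rest[of "C \<union> ?K"] by blast
  qed
qed

section \<open>Shrinking the bag of vertex 2\<close>

lemma kite_bags_swap: "sym E \<Longrightarrow> kite_bags E V a B C D e \<Longrightarrow> kite_bags E V a B D C e"
  unfolding kite_bags_def using touches_sym[of E C D] by (simp add: Int_commute)

text \<open>When only \<open>z\<close> connects \<open>B\<close> with \<open>D\<close>, it can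
  change sides: its neighbour \<open>p\<close> in \<open>B\<close> restores the contact, and
  \<open>a\<close> stays away from the new \<open>D\<close> because it is not adjacent to
  \<open>z\<close>.\<close>

lemma kite_bags_move:
  assumes sym: "sym E" and K: "kite_bags E V a B C D e" and z: "z \<in> B" "conn E (B - {z})" "(p, z) \<in> E" "p \<in> B - {z}"
    and "(a, z) \<notin> E" "touches E (B - {z}) C" "\<not> touches E (B - {z}) D"
  shows "kite_bags E V a (B - {z}) C (insert z D) e"
proof -
  have "touches E {z} D" using touches_remove[OF kite_bags_touches(2)[OF K] assms(9)] .
  then obtain d where d: "d \<in> D" "(z, d) \<in> E" unfolding touches_def by blast
  have "conn E (insert z D)"
    using conn_insert[OF sym _ d] K unfolding kite_bags_def by blast
  moreover have "touches E (B - {z}) (insert z D)"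
    using z unfolding touches_def by blast
  moreover have "touches E {a} (B - {z})"
    using kite_bags_touches(4)[OF K] assms(7) unfolding touches_def by blast
  moreover have "\<not> touches E {a} (insert z D)" "\<not> touches E {e} (B - {z})"
    using kite_bags_nonadj(2,3)[OF K] assms(7) unfolding touches_def by auto
  moreover have "touches E C (insert z D)" "touches E {e} (insert z D)"
    using kite_bags_touches(3,6)[OF K] by (auto intro: touches_mono)
  moreover have "z \<noteq> a" "z \<noteq> e" "z \<notin> C" "z \<in> V" using K z unfolding kite_bags_def by blast+
  ultimately show ?thesis
    using K z(2) assms(8) unfolding kite_bags_def by auto
qed

text \<open>A non-cut vertex \<open>z\<close> is dropped if none of \<open>a\<close>,
  \<open>C\<close>, \<open>D\<close> depends on it, becomes the whole bag if both \<open>C\<close>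
  and \<open>D\<close> depend on it, and is handed over if just one of these does and
  \<open>a\<close> is not adjacent to \<open>z\<close>. The second alternative is what escapes all
  three reductions.\<close>

lemma kite_bags_shrink:
  assumes sym: "sym E" and K: "kite_bags E V a B C D e" and fin: "finite B"
    and z: "z \<in> B" "conn E (B - {z})" "B \<noteq> {z}"
  shows "(\<exists>a' B' C' D'. kite_bags E V a' B' C' D' e \<and> card B' < card B) \<or>
     (a, z) \<in> E \<and> (\<not> touches E {a} (B - {z}) \<or> touches E (B - {z}) C \<noteq> touches E (B - {z}) D)"
proof -
  have cn: "conn E B" using K unfolding kite_bags_def by blast
  obtain y where y: "y \<in> B" "y \<notin> {z}" using z by blast
  obtain p where p: "p \<in> B - {z}" "(p, z) \<in> E"
    using conn_crossing[OF cn z(1) singletonI y] symD[OF sym] by blast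
  have card: "card (B - {z}) < card B" using card_Diff1_less[OF fin z(1)] .
  have z1: "card {z} < card B"
    using psubset_card_mono[OF fin, of "{z}"] z by auto
  consider (drop) "touches E (B - {z}) C" "touches E (B - {z}) D" "touches E {a} (B - {z})"
    | (only) "\<not> touches E (B - {z}) C" "\<not> touches E (B - {z}) D"
    | (D) "(a, z) \<notin> E" "touches E (B - {z}) C" "\<not> touches E (B - {z}) D"
    | (C) "(a, z) \<notin> E" "touches E (B - {z}) D" "\<not> touches E (B - {z}) C"
    | (rest) "(a, z) \<in> E \<and> (\<not> touches E {a} (B - {z}) \<or> touches E (B - {z}) C \<noteq> touches E (B - {z}) D)"
    | (no) "(a, z) \<notin> E" "\<not> touches E {a} (B - {z})"
    by blast
  then show ?thesis
  proof cases
    case drop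
    have "\<not> touches E {e} (B - {z})" using K unfolding kite_bags_def touches_def by blast
    then have "kite_bags E V a (B - {z}) C D e"
      using K drop z(2) unfolding kite_bags_def by auto
    then show ?thesis using card by blast
  next
    case only
    \<comment> \<open>All contacts of \<open>B\<close> with \<open>C\<close> and \<open>D\<close> go
      through \<open>z\<close>, so its neighbour \<open>p\<close> in \<open>B\<close> has none and
      can be the new pendant vertex of the bag \<open>{z}\<close>.\<close>
    have "touches E {z} C" "touches E {z} D"
      using touches_remove[OF kite_bags_touches(1)[OF K] only(1)] touches_remove[OF kite_bags_touches(2)[OF K] only(2)] .
    moreover have "\<not> touches E {p} C" "\<not> touches E {p} D"
      using only touches_mono[of E "{p}" _ "B - {z}"] p(1) by blast+
    moreover have "touches E {p} {z}" "\<not> touches E {e} {z}"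
      using p(2) kite_bags_nonadj(3)[OF K z(1)] by (simp_all add: touches_def)
    moreover have "(p, e) \<notin> E" using kite_bags_nonadj(3)[OF K, of p] p(1) symD[OF sym, of p e] by blast
    moreover have "p \<in> V" "z \<in> V" "p \<noteq> e" "z \<notin> C" "z \<notin> D" "p \<noteq> z" "p \<notin> C" "p \<notin> D" "z \<noteq> e"
      using K p z unfolding kite_bags_def by blast+
    ultimately have "kite_bags E V p {z} C D e"
      using K unfolding kite_bags_def by (simp add: conn_singleton)
    then show ?thesis using z1 by blast
  next
    case D
    then show ?thesis using kite_bags_move[OF sym K z(1,2) p(2,1)] card by blast
  next
    case C
    then show ?thesis using kite_bags_move[OF sym kite_bags_swap[OF sym K] z(1,2) p(2,1)] card by blast
  next
    case no
    then show ?thesis using kite_bags_touches(4)[OF K] unfolding touches_def by blast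
  qed blast
qed

text \<open>
  If only \<open>x\<close> serves \<open>C\<close> and only \<open>y\<close> serves \<open>D\<close>, then \<open>a\<close> itself can connect them, and any other
  vertex of \<open>B\<close> adjacent to \<open>x\<close> or \<open>y\<close> takes over the role of \<open>a\<close>.
\<close>

lemma kite_bags_reroute:
  assumes sym: "sym E" and K: "kite_bags E V a B C D e" and fin: "finite B" "card B > 3"
    and x: "x \<in> B" "(a, x) \<in> E" "\<not> touches E (B - {x}) C"
    and y: "y \<in> B" "(a, y) \<in> E" "\<not> touches E (B - {y}) D"
  shows "\<exists>z. kite_bags E V z {x, a, y} C D e"
proof -
  have cn: "conn E B" using K unfolding kite_bags_def by blast
  have "\<not> B \<subseteq> {x, y}"
    using card_mono[of "{x, y}" B] card_insert_le_m1[of 2 "{y}" x] fin by (auto simp: card_insert_if split: if_splits)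
  then obtain u where u: "u \<in> B" "u \<notin> {x, y}" by blast
  \<comment> \<open>An edge of the connected bag leaving \<open>{x, y}\<close>: its outer end
    \<open>z\<close> sees neither \<open>C\<close> nor \<open>D\<close>, whose contacts with
    \<open>B\<close> are confined to \<open>x\<close> and \<open>y\<close>.\<close>
  obtain q z where z: "q \<in> {x, y}" "z \<in> B" "z \<notin> {x, y}" "(q, z) \<in> E"
    using conn_crossing[OF cn x(1) _ u] by blast
  have zq: "(z, q) \<in> E" using z(4) symD[OF sym] by blast
  have "conn E {x, a, y}"
  proof -
    have "conn E (insert a {y})"
      by (rule conn_insert[OF sym conn_singleton _ y(2)]) simp
    then show ?thesis
      by (rule conn_insert[OF sym, of _ a x]) (use x(2) symD[OF sym] in auto)
  qed
  moreover have "touches E {x, a, y} C"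
    using touches_mono[OF touches_remove[OF kite_bags_touches(1)[OF K] x(3)], of "{x, a, y}" C] by simp
  moreover have "touches E {x, a, y} D"
    using touches_mono[OF touches_remove[OF kite_bags_touches(2)[OF K] y(3)], of "{x, a, y}" D] by simp
  moreover have "touches E {z} {x, a, y}" using z(1) zq unfolding touches_def by blast
  moreover have "\<not> touches E {z} C" "\<not> touches E {z} D"
    using x(3) y(3) z unfolding touches_def by blast+
  moreover have "\<not> touches E {e} {x, a, y}"
    using kite_bags_nonadj(3)[OF K x(1)] kite_bags_nonadj(3)[OF K y(1)] kite_bags_nonadj(4)[OF K] symD[OF sym, of e a]
    by (auto simp: touches_def)
  moreover have "(z, e) \<notin> E"
    using kite_bags_nonadj(3)[OF K z(2)] symD[OF sym, of z e] by blast
  moreover have "z \<in> V" "x \<in> V" "y \<in> V" "z \<noteq> e" "x \<notin> C" "x \<notin> D" "y \<notin> C" "y \<notin> D" "z \<noteq> a" "z \<notin> C" "z \<notin> D" "x \<noteq> e" "y \<noteq> e"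
    using K x y z unfolding kite_bags_def by blast+
  ultimately have "kite_bags E V z {x, a, y} C D e"
    using K z(3) unfolding kite_bags_def by auto
  then show ?thesis by blast
qed

text \<open>If no reduction applies, two non-cut vertices \<open>x\<close>, \<open>y\<close> are
  both adjacent to \<open>a\<close>. So neither is the only contact of \<open>a\<close>, and each is
  indispensable for exactly one of \<open>C\<close> and \<open>D\<close>. It is not the same one for
  both, since a contact lost with \<open>x\<close> is still there when only \<open>y\<close> is
  removed. This is the situation of \<open>kite_bags_reroute\<close>.\<close>

lemma kite_bags_small:
  assumes sym: "sym E" and fin: "finite V" and K: "kite_bags E V a B C D e"
  shows "\<exists>a B C D. kite_bags E V a B C D e \<and> card B \<le> 3"
  using K
proof (induction "card B" arbitrary: a B C D rule: less_induct)
  case less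
  show ?case
  proof (cases "card B \<le> 3")
    case True
    then show ?thesis using less.prems by blast
  next
    case False
    note K = less.prems
    have finB: "finite B" and cn: "conn E B" and ne: "B \<noteq> {}"
      using finite_subset[OF kite_bags_sets(3)[OF K] fin] kite_bags_conn(1)[OF K] kite_bags_touches(4)[OF K]
      by (auto simp: touches_def)
    obtain r where r: "r \<in> B" using ne by blast
    have big: "B \<noteq> {v}" for v using False by auto
    obtain x where x: "x \<in> B" "conn E (B - {x})" using conn_noncut[OF sym cn finB r big] by blast
    \<comment> \<open>Taking \<open>x\<close> as the root makes the second non-cut vertex different
      from the first.\<close>
    obtain y where y: "y \<in> B" "y \<noteq> x" "conn E (B - {y})" using conn_noncut[OF sym cn finB x(1) big] by blast
    have IH: ?thesis if "kite_bags E V a' B' C' D' e" "card B' < card B" for a' B' C' D'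
      using less.hyps[OF that(2,1)] .
    show ?thesis
    proof (cases "\<exists>a' B' C' D'. kite_bags E V a' B' C' D' e \<and> card B' < card B")
      case True
      then show ?thesis using IH by blast
    next
      case no: False
      have X: "(a, x) \<in> E" "\<not> touches E {a} (B - {x}) \<or> touches E (B - {x}) C \<noteq> touches E (B - {x}) D"
        using kite_bags_shrink[OF sym K finB x big] no by blast+
      have Y: "(a, y) \<in> E" "\<not> touches E {a} (B - {y}) \<or> touches E (B - {y}) C \<noteq> touches E (B - {y}) D"
        using kite_bags_shrink[OF sym K finB y(1,3) big] no by blast+
      have ta: "touches E {a} (B - {x})" "touches E {a} (B - {y})"
        using X(1) Y(1) x y unfolding touches_def by blast+
      have "touches E (B - {x}) S \<or> touches E (B - {y}) S" if "touches E B S" for S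
        using that y(2) unfolding touches_def by blast
      then have "touches E (B - {x}) C \<or> touches E (B - {y}) C" "touches E (B - {x}) D \<or> touches E (B - {y}) D"
        using K unfolding kite_bags_def by blast+
      with X(2) Y(2) ta consider "\<not> touches E (B - {x}) C" "\<not> touches E (B - {y}) D"
        | "\<not> touches E (B - {y}) C" "\<not> touches E (B - {x}) D"
        by blast
      then obtain z B' where z: "kite_bags E V z B' C D e" "card B' \<le> 3"
      proof cases
        case 1
        then obtain z where "kite_bags E V z {x, a, y} C D e"
          using kite_bags_reroute[OF sym K finB _ x(1) X(1) _ y(1) Y(1)] False by auto
        then show ?thesis using that card_length[of "[x, a, y]"] by simp
      next
        case 2
        then obtain z where "kite_bags E V z {y, a, x} C D e"
          using kite_bags_reroute[OF sym K finB _ y(1) Y(1) _ x(1) X(1)] False by auto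
        then show ?thesis using that card_length[of "[y, a, x]"] by simp
      qed
      then show ?thesis by blast
    qed
  qed
qed

text \<open>A walk with repetitions allowed describes a bag of any size from one to three by the
  same three variables, which spares the formula a case distinction.\<close>

lemma conn_card_le_3:
  assumes "sym E" "conn E B" "finite B" "B \<noteq> {}" "card B \<le> 3"
  obtains x y z where "B = {x, y, z}" "x = y \<or> (x, y) \<in> E" "y = z \<or> (y, z) \<in> E"
proof -
  consider "card B = 1" | "card B = 2" | "card B = 3"
    using assms(3-5) card_gt_0_iff[of B] by linarith
  then show ?thesis
  proof cases
    case 1
    then obtain x where "B = {x}" using card_1_singletonE by blast
    then show ?thesis using that[of x x x] by simp
  next
    case 2
    then obtain x y where B: "B = {x, y}" "x \<noteq> y" by (meson card_2_iff)
    then obtain p q where "p \<in> {x, y}" "p \<in> {x}" "q \<in> {x, y}" "q \<notin> {x}" "(p, q) \<in> E"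
      using conn_crossing[OF assms(2), of x "{x}" y] by blast
    then have "(x, y) \<in> E" by auto
    then show ?thesis using that[of x y y] B by simp
  next
    case 3
    then obtain x y z where B: "B = {x, y, z}" "x \<noteq> y" "y \<noteq> z" "x \<noteq> z" by (auto simp: card_3_iff)
    have cr: "\<exists>q\<in>B - {p}. (p, q) \<in> E" if "p \<in> B" for p
    proof -
      obtain r where "r \<in> B" "r \<notin> {p}" using B by blast
      then show ?thesis using conn_crossing[OF assms(2) that, of "{p}" r] by blast
    qed
    have s: "(u, v) \<in> E \<longleftrightarrow> (v, u) \<in> E" for u v using symD[OF assms(1)] by blast
    \<comment> \<open>Each vertex has a neighbour among the other two, so at least two of the three
      edges are present, and their common end becomes the middle of the walk.\<close>
    have "((x, y) \<in> E \<or> (x, z) \<in> E) \<and> ((x, y) \<in> E \<or> (y, z) \<in> E) \<and> ((x, z) \<in> E \<or> (y, z) \<in> E)"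
      using cr[of x] cr[of y] cr[of z] B s by blast
    then consider "(x, y) \<in> E" "(y, z) \<in> E" | "(x, y) \<in> E" "(x, z) \<in> E" | "(x, z) \<in> E" "(y, z) \<in> E" by blast
    then show ?thesis
    proof cases
      case 1
      then show ?thesis using that[of x y z] B by simp
    next
      case 2
      then show ?thesis using that[of y x z] B s by auto
    next
      case 3
      then show ?thesis using that[of x z y] B s by auto
    qed
  qed
qed

lemma conn_triple:
  assumes "sym E" "x = y \<or> (x, y) \<in> E" "y = z \<or> (y, z) \<in> E"
  shows "conn E {x, y, z}"
proof -
  have "conn E {y, z}"
    using conn_insert[OF assms(1) conn_singleton, of z z y] assms(3) by (auto simp: conn_singleton)
  then show ?thesis
    using conn_insert[OF assms(1), of "{y, z}" y x] assms(2) by (auto simp: insert_absorb)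
qed

definition kite_rest :: "('a \<times> 'a) set \<Rightarrow> 'a set \<Rightarrow> 'a \<Rightarrow> 'a set \<Rightarrow> 'a \<Rightarrow> 'a set" where
  "kite_rest E V a B e = {x \<in> V. x \<noteq> a \<and> x \<noteq> e \<and> x \<notin> B \<and> (a, x) \<notin> E}"

text \<open>The conditions are sorted: those on \<open>a\<close>, \<open>B\<close>, \<open>e\<close>
  alone come first, and the remaining ones take exactly the shape of
  \<open>two_linked_touching_iff\<close>.\<close>

lemma kite_bags_iff:
  assumes "sym E"
  shows "kite_bags E V a B C D e \<longleftrightarrow>
    a \<in> V \<and> e \<in> V \<and> B \<subseteq> V \<and> a \<noteq> e \<and> a \<notin> B \<and> e \<notin> B \<and> conn E B \<and> touches E {a} B \<and> \<not> touches E {e} B \<and> (a, e) \<notin> E \<and>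
    (C \<subseteq> kite_rest E V a B e \<and> D \<subseteq> kite_rest E V a B e \<and> C \<inter> D = {} \<and> conn E C \<and> conn E D \<and> touches E C D \<and>
      C \<inter> E `` B \<noteq> {} \<and> C \<inter> E `` {e} \<noteq> {} \<and> D \<inter> E `` B \<noteq> {} \<and> D \<inter> E `` {e} \<noteq> {})"
proof -
  have t: "touches E S T \<longleftrightarrow> T \<inter> E `` S \<noteq> {}" for S T
    unfolding touches_def by blast
  have w: "S \<subseteq> kite_rest E V a B e \<longleftrightarrow> S \<subseteq> V \<and> a \<notin> S \<and> e \<notin> S \<and> B \<inter> S = {} \<and> \<not> touches E {a} S" for S
    unfolding kite_rest_def touches_def by blast
  show ?thesis
    unfolding kite_bags_def w t[of B C] t[of B D] t[of "{e}" C] t[of "{e}" D] by argo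
qed

lemma kite_minor_iff:
  assumes "pair_graph G"
  defines "E \<equiv> parcs G" and "V \<equiv> pverts G"
  shows "contains_induced_minor G kite \<longleftrightarrow>
    (\<exists>a\<in>V. \<exists>x\<in>V. \<exists>y\<in>V. \<exists>z\<in>V. \<exists>e\<in>V. a \<noteq> e \<and> a \<notin> {x, y, z} \<and> e \<notin> {x, y, z} \<and>
       (x = y \<or> (x, y) \<in> E) \<and> (y = z \<or> (y, z) \<in> E) \<and> touches E {a} {x, y, z} \<and> \<not> touches E {e} {x, y, z} \<and> (a, e) \<notin> E \<and>
       doubly_linked E (kite_rest E V a {x, y, z} e) (E `` {x, y, z}) (E `` {e}))" (is "_ \<longleftrightarrow> ?R")
proof -
  interpret pair_graph G by fact
  have sym: "sym E" unfolding E_def by (rule symI) (use pair_graph_arc[OF assms(1)] in blast)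
  have fin: "finite V" unfolding V_def by simp
  have finW: "finite (kite_rest E V a B e)" for a B e
    using fin by (simp add: kite_rest_def)
  have "contains_induced_minor G kite \<longleftrightarrow> (\<exists>a B C D e. kite_bags E V a B C D e)"
    using contains_induced_minor_iff_model[OF assms(1) pair_graph_kite]
      kite_bags_if_minor_model[of G] minor_model_kite_if_bags[of G] sym
    unfolding E_def V_def by blast
  also have "\<dots> \<longleftrightarrow> ?R"
  proof
    assume "\<exists>a B C D e. kite_bags E V a B C D e"
    then obtain a B C D e where K: "kite_bags E V a B C D e" "card B \<le> 3"
      using kite_bags_small[OF sym fin] by blast
    have B: "conn E B" "finite B" "B \<noteq> {}" "B \<subseteq> V"
      using finite_subset[OF kite_bags_sets(3)[OF K(1)] fin] kite_bags_conn(1)[OF K(1)]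
        kite_bags_touches(4)[OF K(1)] kite_bags_sets(3)[OF K(1)]
      by (auto simp: touches_def)
    obtain x y z where xyz: "B = {x, y, z}" "x = y \<or> (x, y) \<in> E" "y = z \<or> (y, z) \<in> E"
      using conn_card_le_3[OF sym B(1-3) K(2)] .
    note F = K(1)[unfolded kite_bags_iff[OF sym]]
    have "doubly_linked E (kite_rest E V a B e) (E `` B) (E `` {e})"
      unfolding two_linked_touching_iff[OF sym finW, symmetric]
      by (rule exI[of _ C], rule exI[of _ D]) (use F in simp)
    then show ?R
      using F xyz B(4) unfolding xyz(1)
      by (intro bexI[of _ a] bexI[of _ x] bexI[of _ y] bexI[of _ z] bexI[of _ e]) simp_all
  next
    assume ?R
    then obtain a x y z e where *: "a \<in> V" "x \<in> V" "y \<in> V" "z \<in> V" "e \<in> V" "a \<noteq> e" "a \<notin> {x, y, z}" "e \<notin> {x, y, z}"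
       "x = y \<or> (x, y) \<in> E" "y = z \<or> (y, z) \<in> E" "touches E {a} {x, y, z}" "\<not> touches E {e} {x, y, z}" "(a, e) \<notin> E"
      and W: "doubly_linked E (kite_rest E V a {x, y, z} e) (E `` {x, y, z}) (E `` {e})"
      by (elim bexE conjE)
    from W obtain C D where CD: "C \<subseteq> kite_rest E V a {x, y, z} e \<and> D \<subseteq> kite_rest E V a {x, y, z} e \<and>
        C \<inter> D = {} \<and> conn E C \<and> conn E D \<and> touches E C D \<and> C \<inter> E `` {x, y, z} \<noteq> {} \<and> C \<inter> E `` {e} \<noteq> {} \<and>
        D \<inter> E `` {x, y, z} \<noteq> {} \<and> D \<inter> E `` {e} \<noteq> {}"
      unfolding two_linked_touching_iff[OF sym finW, symmetric] by (elim exE)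
    have "kite_bags E V a {x, y, z} C D e"
      unfolding kite_bags_iff[OF sym] using * CD conn_triple[OF sym *(9,10)] by simp
    then show "\<exists>a B C D e. kite_bags E V a B C D e" by blast
  qed
  finally show ?thesis .
qed

section \<open>The formula for the kite\<close>

text \<open>For \<open>y\<close> beyond \<open>n\<close> this would read an entry of a later row;
  the formulas below therefore guard their vertex variables by \<open>n\<close>.\<close>

definition word_adj :: "bool list \<Rightarrow> nat \<Rightarrow> nat \<Rightarrow> nat \<Rightarrow> bool" where
  "word_adj w n x y \<longleftrightarrow> x * n + y < length w \<and> w ! (x * n + y)"

definition word_reach :: "bool list \<Rightarrow> (nat \<Rightarrow> nat \<Rightarrow> bool) \<Rightarrow> nat \<Rightarrow> nat \<Rightarrow> bool" where
  "word_reach w R s t \<longleftrightarrow> (s, t) \<in> {(x, y). x \<le> length w \<and> y \<le> length w \<and> R x y}\<^sup>*"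

definition word_rest :: "bool list \<Rightarrow> nat \<Rightarrow> nat \<Rightarrow> nat \<Rightarrow> nat \<Rightarrow> nat \<Rightarrow> nat \<Rightarrow> nat \<Rightarrow> bool" where
  "word_rest w n a x y z e u \<longleftrightarrow>
     u < n \<and> u \<noteq> a \<and> u \<noteq> x \<and> u \<noteq> y \<and> u \<noteq> z \<and> u \<noteq> e \<and> \<not> word_adj w n a u"

text \<open>\<open>doubly_linked\<close> in the form that the decision procedure accepts: all
  quantifiers are bounded by \<open>length w\<close>, and the relations that are searched contain no
  reachability themselves.\<close>

definition word_linked :: "bool list \<Rightarrow> nat \<Rightarrow> nat \<Rightarrow> nat \<Rightarrow> nat \<Rightarrow> nat \<Rightarrow> nat \<Rightarrow> bool" where
  "word_linked w n a x y z e \<longleftrightarrow> (\<exists>k\<le>length w. word_rest w n a x y z e k \<and>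
     (\<forall>v\<le>length w. word_rest w n a x y z e v \<longrightarrow>
        word_reach w (\<lambda>p q. word_rest w n a x y z e p \<and> word_rest w n a x y z e q \<and> word_adj w n p q) k v \<longrightarrow>
        (\<exists>s\<le>length w. word_rest w n a x y z e s \<and> s \<noteq> v \<and> (\<exists>t\<le>length w. word_rest w n a x y z e t \<and> t \<noteq> v \<and>
           (word_adj w n x s \<or> word_adj w n y s \<or> word_adj w n z s) \<and> word_adj w n e t \<and>
           word_reach w (\<lambda>p q. word_rest w n a x y z e p \<and> word_rest w n a x y z e q \<and> word_adj w n p q) k s \<and>
           word_reach w (\<lambda>p q. (word_rest w n a x y z e p \<and> p \<noteq> v) \<and> (word_rest w n a x y z e q \<and> q \<noteq> v) \<and>
             word_adj w n p q) s t))))"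

definition word_kite :: "bool list \<Rightarrow> nat \<Rightarrow> bool" where
  "word_kite w n \<longleftrightarrow> (\<exists>a\<le>length w. a < n \<and> (\<exists>x\<le>length w. x < n \<and> (\<exists>y\<le>length w. y < n \<and> (\<exists>z\<le>length w. z < n \<and>
     (\<exists>e\<le>length w. e < n \<and> a \<noteq> e \<and> (a \<noteq> x \<and> a \<noteq> y \<and> a \<noteq> z) \<and> (e \<noteq> x \<and> e \<noteq> y \<and> e \<noteq> z) \<and>
       (x = y \<or> word_adj w n x y) \<and> (y = z \<or> word_adj w n y z) \<and>
       (word_adj w n a x \<or> word_adj w n a y \<or> word_adj w n a z) \<and>
       \<not> (word_adj w n e x \<or> word_adj w n e y \<or> word_adj w n e z) \<and> \<not> word_adj w n a e \<and>
       word_linked w n a x y z e)))))"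

definition word_graph :: "bool list \<Rightarrow> nat \<Rightarrow> bool" where
  "word_graph w n \<longleftrightarrow> n * n = length w \<and> (\<forall>x\<le>length w. \<forall>y\<le>length w. x < n \<and> y < n \<longrightarrow>
     (word_adj w n x y \<longleftrightarrow> word_adj w n y x) \<and> \<not> word_adj w n x x)"

section \<open>Decidability of the formulas\<close>

lemma dec_word_adj: "x < d \<Longrightarrow> n < d \<Longrightarrow> y < d \<Longrightarrow> dec pres d (\<lambda>w e. word_adj w (e n) (e x) (e y))"
  unfolding word_adj_def by (rule dec_bit)

lemma dec_word_reach:
  assumes "dec True (d + 4) (\<lambda>w e. R w e (e (d + 2)) (e (d + 3)))"
    and "\<And>w e e'. \<forall>v<d. e v = e' v \<Longrightarrow> R w e = R w e'"
    and "s < d" "t < d"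
  shows "dec False d (\<lambda>w e. word_reach w (R w e) (e s) (e t))"
  unfolding word_reach_def by (rule dec_reach[OF assms])

lemmas dec_rules = dec_and dec_or dec_imp dec_iff dec_not dec_ex dec_all dec_less dec_eq dec_square dec_word_adj

lemma dec_word_rest:
  assumes "n < d" "a < d" "x < d" "y < d" "z < d" "v < d" "u < d"
  shows "dec pres d (\<lambda>w e. word_rest w (e n) (e a) (e x) (e y) (e z) (e v) (e u))"
  unfolding word_rest_def by (intro dec_rules assms)

lemma dec_word_linked:
  assumes "n < d" "a < d" "x < d" "y < d" "z < d" "v < d"
  shows "dec False d (\<lambda>w e. word_linked w (e n) (e a) (e x) (e y) (e z) (e v))"
  unfolding word_linked_def using assms
  by (intro dec_rules dec_word_rest dec_word_reach) simp_all

lemma dec_word_kite: "n < d \<Longrightarrow> dec False d (\<lambda>w e. word_kite w (e n))"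
  unfolding word_kite_def by (intro dec_rules dec_word_linked) simp_all

lemma dec_word_graph: "n < d \<Longrightarrow> dec False d (\<lambda>w e. word_graph w (e n))"
  unfolding word_graph_def by (intro dec_rules) simp_all

section \<open>Words as adjacency matrices\<close>

lemma concat_map_eq_map_div_mod:
  fixes f :: "nat \<Rightarrow> nat \<Rightarrow> 'b"
  shows "concat (map (\<lambda>i. map (f i) [0..<n]) [0..<k]) = map (\<lambda>i. f (i div n) (i mod n)) [0..<k * n]"
proof (induction k)
  case (Suc k)
  have "map (\<lambda>i. f (i div n) (i mod n)) [k * n..<k * n + n] = map (f k) [0..<n]"
    by (intro nth_equalityI) auto
  moreover have "[0..<Suc k * n] = [0..<k * n] @ [k * n..<k * n + n]"
    using upt_add_eq_append[of 0 "k * n" n] by (simp add: add.commute)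
  ultimately show ?case using Suc by simp
qed simp

lemma nth_adjacency_word:
  assumes "x < n" "y < n"
  shows "adjacency_word n G ! (x * n + y) \<longleftrightarrow> (x, y) \<in> parcs G" "x * n + y < n * n"
proof -
  have "x * n + y < x * n + n" using assms by simp
  also have "\<dots> \<le> n * n" using mult_le_mono1[of "Suc x" n n] assms by simp
  finally show lt: "x * n + y < n * n" .
  have "0 < n" using assms by simp
  then show "adjacency_word n G ! (x * n + y) \<longleftrightarrow> (x, y) \<in> parcs G"
    unfolding adjacency_word_def
    using concat_map_eq_map_div_mod[of "\<lambda>i j. (i, j) \<in> parcs G" n n] lt assms by simp
qed

definition graph_of_word :: "bool list \<Rightarrow> nat \<Rightarrow> nat pair_pre_digraph" where
  "graph_of_word w n = \<lparr>pverts = {0..<n}, parcs = {(x, y). x < n \<and> y < n \<and> word_adj w n x y}\<rparr>"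

lemma adjacency_word_graph_of_word:
  assumes "n * n = length w"
  shows "adjacency_word n (graph_of_word w n) = w"
proof (rule nth_equalityI)
  show len: "length (adjacency_word n (graph_of_word w n)) = length w"
    using assms by (simp add: length_adjacency_word)
  fix i assume "i < length (adjacency_word n (graph_of_word w n))"
  then have i: "i < n * n" using len assms by simp
  then have "0 < n" by (cases n) auto
  then have xy: "i div n < n" "i mod n < n" using i by (simp_all add: less_mult_imp_div_less)
  have "adjacency_word n (graph_of_word w n) ! (i div n * n + i mod n) \<longleftrightarrow> word_adj w n (i div n) (i mod n)"
    using nth_adjacency_word(1)[OF xy, of "graph_of_word w n"] xy by (simp add: graph_of_word_def)
  then show "adjacency_word n (graph_of_word w n) ! i = w ! i"
    using i assms by (simp add: word_adj_def)
qed

lemma word_graph_iff: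
  assumes "n * n = length w"
  shows "word_graph w n \<longleftrightarrow> pair_graph (graph_of_word w n)"
proof -
  let ?G = "graph_of_word w n"
  have n: "n \<le> length w" using assms by (metis le_square)
  have fin: "finite (parcs ?G)"
    by (rule finite_subset[of _ "{0..<n} \<times> {0..<n}"]) (auto simp: graph_of_word_def)
  show ?thesis
  proof
    assume W: "word_graph w n"
    have *: "(word_adj w n x y \<longleftrightarrow> word_adj w n y x) \<and> \<not> word_adj w n x x" if "x < n" "y < n" for x y
    proof -
      have "x \<le> length w" "y \<le> length w" using that n by simp_all
      then show ?thesis using W that unfolding word_graph_def by blast
    qed
    show "pair_graph ?G"
    proof
      show "finite (parcs ?G)" by fact
      show "fst e \<noteq> snd e" if "e \<in> parcs ?G" for e
        using that * unfolding graph_of_word_def by auto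
      show "symmetric (with_proj ?G)"
        using * unfolding symmetric_def graph_of_word_def by (auto intro!: symI)
    qed (auto simp: graph_of_word_def)
  next
    assume G: "pair_graph ?G"
    show "word_graph w n"
      unfolding word_graph_def
    proof (intro conjI allI impI assms)
      fix x y assume "x < n \<and> y < n"
      then have xy: "x < n" "y < n" by auto
      then have arc: "(x, y) \<in> parcs ?G \<longleftrightarrow> word_adj w n x y" "(y, x) \<in> parcs ?G \<longleftrightarrow> word_adj w n y x"
          "(x, x) \<in> parcs ?G \<longleftrightarrow> word_adj w n x x"
        by (auto simp: graph_of_word_def)
      show "word_adj w n x y \<longleftrightarrow> word_adj w n y x" "\<not> word_adj w n x x"
        using pair_graph_arc(3,4)[OF G] unfolding arc[symmetric] by blast+
    qed
  qed
qed

lemma bex_bounded: "n \<le> L \<Longrightarrow> (\<exists>x\<le>L. x < n \<and> P x) \<longleftrightarrow> (\<exists>x\<in>{0..<n}. P x)" for n L :: nat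
  by (meson atLeastLessThan_iff le0 less_imp_le_nat order_trans)

text \<open>Members of \<open>kite_rest\<close> are below \<open>n\<close> and hence at most
  \<open>length w\<close>, so bounding the quantifiers and the searched relations by
  \<open>length w\<close> loses nothing.\<close>

lemma word_linked_iff:
  assumes n: "n \<le> length w" and lt: "a < n" "x < n" "y < n" "z < n" "e < n"
  defines "E \<equiv> parcs (graph_of_word w n)" and "V \<equiv> pverts (graph_of_word w n)"
  shows "doubly_linked E (kite_rest E V a {x, y, z} e) (E `` {x, y, z}) (E `` {e}) \<longleftrightarrow> word_linked w n a x y z e"
proof -
  let ?W = "kite_rest E V a {x, y, z} e" and ?r = "word_rest w n a x y z e"
  have W: "u \<in> ?W \<longleftrightarrow> ?r u" for u
    unfolding kite_rest_def word_rest_def E_def V_def graph_of_word_def using lt by auto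
  have bound: "?r u \<Longrightarrow> u < n \<and> u \<le> length w" for u
    using n unfolding word_rest_def by simp
  have 1: "E \<inter> ?W \<times> ?W = {(p, q). p \<le> length w \<and> q \<le> length w \<and> ?r p \<and> ?r q \<and> word_adj w n p q}"
    using bound W by (auto simp: E_def graph_of_word_def)
  have 2: "E \<inter> (?W - {v}) \<times> (?W - {v}) =
      {(p, q). p \<le> length w \<and> q \<le> length w \<and> (?r p \<and> p \<noteq> v) \<and> (?r q \<and> q \<noteq> v) \<and> word_adj w n p q}" for v
    using bound W by (auto simp: E_def graph_of_word_def)
  have 3: "s \<in> E `` {x, y, z} \<longleftrightarrow> word_adj w n x s \<or> word_adj w n y s \<or> word_adj w n z s" if "?r s" for s
    using bound[OF that] lt by (auto simp: E_def graph_of_word_def)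
  have 4: "t \<in> E `` {e} \<longleftrightarrow> word_adj w n e t" if "?r t" for t
    using bound[OF that] lt by (auto simp: E_def graph_of_word_def)
  have bexW: "(\<exists>u\<in>?W - {v}. P u) \<longleftrightarrow> (\<exists>u\<le>length w. ?r u \<and> u \<noteq> v \<and> P u)"
    and bexW': "(\<exists>u\<in>?W. P u) \<longleftrightarrow> (\<exists>u\<le>length w. ?r u \<and> P u)"
    and ballW: "(\<forall>u\<in>?W. P u) \<longleftrightarrow> (\<forall>u\<le>length w. ?r u \<longrightarrow> P u)" for P v
    using bound W by blast+
  show ?thesis
    unfolding doubly_linked_def word_linked_def word_reach_def bexW bexW' ballW 1 2
    using 3 4 by (simp cong: conj_cong)
qed

lemma word_kite_iff:
  assumes "n * n = length w" "pair_graph (graph_of_word w n)"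
  shows "contains_induced_minor (graph_of_word w n) kite \<longleftrightarrow> word_kite w n"
proof -
  have n: "n \<le> length w" using assms(1) by (metis le_square)
  have V: "pverts (graph_of_word w n) = {0..<n}" by (simp add: graph_of_word_def)
  have E: "(x, y) \<in> parcs (graph_of_word w n) \<longleftrightarrow> word_adj w n x y" if "x < n" "y < n" for x y
    using that by (simp add: graph_of_word_def)
  show ?thesis
    unfolding kite_minor_iff[OF assms(2)] word_kite_def bex_bounded[OF n] V
    by (intro bex_cong refl) (simp add: word_linked_iff[OF n, unfolded V] E touches_def)
qed

text \<open>The machine is given only the length of the word, so the number \<open>n\<close> of
  vertices is itself a quantified variable, determined by \<open>n * n = length w\<close> and thus
  at most \<open>length w\<close>. Words that encode no graph are rejected by
  \<open>word_graph\<close>.\<close>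

lemma induced_minor_problem_kite_iff:
  "w \<in> induced_minor_problem kite \<longleftrightarrow> (\<exists>n\<le>length w. word_graph w n \<and> word_kite w n)"
proof
  assume "w \<in> induced_minor_problem kite"
  then obtain n G where G: "w = adjacency_word n G" "pair_graph G" "pverts G = {0..<n}" "contains_induced_minor G kite"
    unfolding induced_minor_problem_def by blast
  have len: "n * n = length w" using G(1) by (simp add: length_adjacency_word)
  have "parcs (graph_of_word w n) = parcs G"
  proof (intro set_eqI)
    fix a :: "nat \<times> nat"
    obtain x y where a: "a = (x, y)" by (cases a)
    show "a \<in> parcs (graph_of_word w n) \<longleftrightarrow> a \<in> parcs G"
    proof (cases "x < n \<and> y < n")
      case True
      then show ?thesis
        using nth_adjacency_word(1)[of x n y G] nth_adjacency_word(2)[of x n y] len G(1) by (simp add: a graph_of_word_def word_adj_def)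
    next
      case False
      then show ?thesis
        using pair_graph_arc(1,2)[OF G(2), of x y] G(3) by (auto simp: a graph_of_word_def)
    qed
  qed
  then have "graph_of_word w n = G"
    using G(3) by (intro pair_pre_digraph.equality) (simp_all add: graph_of_word_def)
  moreover have "n \<le> length w" using len by (metis le_square)
  ultimately show "\<exists>n\<le>length w. word_graph w n \<and> word_kite w n"
    using G(2,4) len word_graph_iff[OF len] word_kite_iff[OF len] by auto
next
  assume "\<exists>n\<le>length w. word_graph w n \<and> word_kite w n"
  then obtain n where n: "word_graph w n" "word_kite w n" by blast
  then have len: "n * n = length w" by (simp add: word_graph_def)
  have G: "pair_graph (graph_of_word w n)" using n(1) word_graph_iff[OF len] by simp
  have "contains_induced_minor (graph_of_word w n) kite" using word_kite_iff[OF len G] n(2) by simp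
  moreover have "pverts (graph_of_word w n) = {0..<n}" by (simp add: graph_of_word_def)
  ultimately show "w \<in> induced_minor_problem kite"
    using adjacency_word_graph_of_word[OF len] G unfolding induced_minor_problem_def
    by (intro CollectI exI[of _ n] exI[of _ "graph_of_word w n"]) simp
qed

theorem theorem7:
  shows "polytime_decidable (induced_minor_problem kite)"
proof (rule polytime_decidableI)
  show "dec False 0 (\<lambda>w e. w \<in> induced_minor_problem kite)"
    unfolding induced_minor_problem_kite_iff
    by (intro dec_rules dec_word_graph dec_word_kite) simp_all
qed

end
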